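(* A matroid $M$ is a lattice path matroid if and only if its ground set can be written as $\{x_1,x_2,\ldots,x_k\}$ so that each restriction $M_i:=M|\{x_1,\ldots,x_i\}$ is formed from $M_{i-1}$ by either (i) adding $x_i$ as an isthmus, (ii) adding $x_i$ as a loop, or (iii) adding $x_i$ via the principal extension of $M_{i-1}$ generated by the closure of an independent set of the form $\{x_h,x_{h+1},\ldots,x_{i-1}\}$ for some $h<i$.
   Context: Lattice paths start at $(0,0)$ and use steps $E=(1,0)$ and $N=(0,1)$. For lattice paths $P,Q$ from $(0,0)$ to $(m,r)$ with $P$ never going above $Q$, let $\mathcal{P}$ be the set of lattice paths from $(0,0)$ to $(m,r)$ going neither above $Q$ nor below $P$, and for $1\le i\le r$ let $N_i=\{j:\text{step } j \text{ is the } i\text{-th North step of some path in }\mathcal{P}\}$. $M[P,Q]$ is the transversal matroid on $[m+r]$ with presentation $(N_1,\ldots,N_r)$; a lattice path matroid is a matroid isomorphic to some $M[P,Q]$. $M_0$ is the empty matroid. The principal extension of a matroid generated by a flat $F$ adds a new element freely placed on $F$ (i.e., in the closure of $F$ and as generic as possible there). *)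

theory Defs
  imports Main
begin

section \<open>Finite matroids\<close>

record 'a set_system =
  ground :: "'a set"
  indep :: "'a set set"

locale matroid =
  fixes M :: "'a set_system"
  assumes finite_ground: "finite (ground M)"
    and indep_subset_ground: "I \<in> indep M \<Longrightarrow> I \<subseteq> ground M"
    and empty_indep: "{} \<in> indep M"
    and indep_subset: "I \<in> indep M \<Longrightarrow> J \<subseteq> I \<Longrightarrow> J \<in> indep M"
    and augment: "I \<in> indep M \<Longrightarrow> J \<in> indep M \<Longrightarrow> card I < card J \<Longrightarrow>
      \<exists>y \<in> J - I. insert y I \<in> indep M"

definition restrict_to :: "'a set_system \<Rightarrow> 'a set \<Rightarrow> 'a set_system" where
  "restrict_to M X = \<lparr>ground = ground M \<inter> X, indep = {I \<in> indep M. I \<subseteq> X}\<rparr>"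

definition basis :: "'a set_system \<Rightarrow> 'a set \<Rightarrow> bool" where
  "basis M B \<longleftrightarrow> B \<in> indep M \<and> (\<forall>I \<in> indep M. B \<subseteq> I \<longrightarrow> I = B)"

definition rank :: "'a set_system \<Rightarrow> 'a set \<Rightarrow> nat" where
  "rank M X = Max {card I | I. I \<in> indep M \<and> I \<subseteq> X}"

definition closure :: "'a set_system \<Rightarrow> 'a set \<Rightarrow> 'a set" where
  "closure M X = {y \<in> ground M. rank M (insert y X) = rank M X}"

definition flat :: "'a set_system \<Rightarrow> 'a set \<Rightarrow> bool" where
  "flat M F \<longleftrightarrow> F \<subseteq> ground M \<and> closure M F = F"

definition loop :: "'a set_system \<Rightarrow> 'a \<Rightarrow> bool" where
  "loop M x \<longleftrightarrow> x \<in> ground M \<and> {x} \<notin> indep M"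

definition isthmus :: "'a set_system \<Rightarrow> 'a \<Rightarrow> bool" where
  "isthmus M x \<longleftrightarrow> x \<in> ground M \<and> (\<forall>B. basis M B \<longrightarrow> x \<in> B)"

definition isomorphic :: "'a set_system \<Rightarrow> 'b set_system \<Rightarrow> bool" where
  "isomorphic M M' \<longleftrightarrow> (\<exists>f. bij_betw f (ground M) (ground M') \<and>
     (\<forall>X \<subseteq> ground M. X \<in> indep M \<longleftrightarrow> f ` X \<in> indep M'))"


section \<open>Single-element extensions\<close>

definition extension_by :: "'a set_system \<Rightarrow> 'a \<Rightarrow> 'a set_system \<Rightarrow> bool" where
  "extension_by M x M' \<longleftrightarrow> matroid M' \<and> x \<notin> ground M \<and>
     ground M' = insert x (ground M) \<and> restrict_to M' (ground M) = M"

definition adds_isthmus :: "'a set_system \<Rightarrow> 'a \<Rightarrow> 'a set_system \<Rightarrow> bool" where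
  "adds_isthmus M x M' \<longleftrightarrow> extension_by M x M' \<and> isthmus M' x"

definition adds_loop :: "'a set_system \<Rightarrow> 'a \<Rightarrow> 'a set_system \<Rightarrow> bool" where
  "adds_loop M x M' \<longleftrightarrow> extension_by M x M' \<and> loop M' x"

text \<open>
  The principal extension generated by the flat \<open>F\<close> is the extension that corresponds to the
  modular cut of all flats containing \<open>F\<close>: a flat \<open>G\<close> of \<open>M\<close> spans the new element \<open>x\<close> exactly
  when \<open>F \<subseteq> G\<close>. The case \<open>G = F\<close> puts \<open>x\<close> in the closure of \<open>F\<close>; the implication from left to
  right is genericity, as every extension with \<open>x\<close> in the closure of \<open>F\<close> satisfies the converse.
\<close>

definition principal_extension ::
    "'a set_system \<Rightarrow> 'a set \<Rightarrow> 'a \<Rightarrow> 'a set_system \<Rightarrow> bool" where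
  "principal_extension M F x M' \<longleftrightarrow> extension_by M x M' \<and> flat M F \<and>
     (\<forall>G. flat M G \<longrightarrow> (x \<in> closure M' G \<longleftrightarrow> F \<subseteq> G))"


section \<open>Lattice path matroids\<close>

datatype step = East | North

type_synonym lattice_path = "step list"

fun move :: "step \<Rightarrow> nat \<times> nat \<Rightarrow> nat \<times> nat" where
  "move East (x, y) = (Suc x, y)"
| "move North (x, y) = (x, Suc y)"

definition endpoint :: "lattice_path \<Rightarrow> nat \<times> nat" where
  "endpoint R = fold move R (0, 0)"

definition points :: "lattice_path \<Rightarrow> (nat \<times> nat) set" where
  "points R = {endpoint (take j R) | j. j \<le> length R}"

text \<open>
  Paths with common endpoints are compared on vertical lines. As paths follow the edges of the
  grid, it suffices to look at the vertical lines through lattice points.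
\<close>

definition goes_above :: "lattice_path \<Rightarrow> lattice_path \<Rightarrow> bool" where
  "goes_above R Q \<longleftrightarrow> (\<exists>x y. (x, y) \<in> points R \<and> (\<forall>y'. (x, y') \<in> points Q \<longrightarrow> y' < y))"

definition goes_below :: "lattice_path \<Rightarrow> lattice_path \<Rightarrow> bool" where
  "goes_below R P \<longleftrightarrow> (\<exists>x y. (x, y) \<in> points R \<and> (\<forall>y'. (x, y') \<in> points P \<longrightarrow> y < y'))"

definition paths_between :: "nat \<Rightarrow> nat \<Rightarrow> lattice_path \<Rightarrow> lattice_path \<Rightarrow> lattice_path set" where
  "paths_between m r P Q =
     {R. endpoint R = (m, r) \<and> \<not> goes_above R Q \<and> \<not> goes_below R P}"

text \<open>Steps are numbered from 1, whereas list positions start at 0.\<close>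

definition is_ith_north_step :: "lattice_path \<Rightarrow> nat \<Rightarrow> nat \<Rightarrow> bool" where
  "is_ith_north_step R i j \<longleftrightarrow> 1 \<le> j \<and> j \<le> length R \<and> R ! (j - 1) = North \<and>
     count_list (take j R) North = i"

definition north_set ::
    "nat \<Rightarrow> nat \<Rightarrow> lattice_path \<Rightarrow> lattice_path \<Rightarrow> nat \<Rightarrow> nat set" where
  "north_set m r P Q i = {j. \<exists>R \<in> paths_between m r P Q. is_ith_north_step R i j}"

text \<open>The independent sets of a transversal matroid are the partial transversals of the family
  \<open>A 1, \<dots>, A r\<close>.\<close>

definition transversal_matroid :: "'a set \<Rightarrow> nat \<Rightarrow> (nat \<Rightarrow> 'a set) \<Rightarrow> 'a set_system" where
  "transversal_matroid S r A = \<lparr>ground = S,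
     indep = {I. I \<subseteq> S \<and> (\<exists>\<phi>. inj_on \<phi> I \<and> \<phi> ` I \<subseteq> {1..r} \<and> (\<forall>e \<in> I. e \<in> A (\<phi> e)))}\<rparr>"

definition path_matroid ::
    "nat \<Rightarrow> nat \<Rightarrow> lattice_path \<Rightarrow> lattice_path \<Rightarrow> nat set_system" where
  "path_matroid m r P Q = transversal_matroid {1..m + r} r (north_set m r P Q)"

definition lattice_path_matroid :: "'a set_system \<Rightarrow> bool" where
  "lattice_path_matroid M \<longleftrightarrow> matroid M \<and>
     (\<exists>m r P Q. endpoint P = (m, r) \<and> endpoint Q = (m, r) \<and> \<not> goes_above P Q \<and>
        isomorphic M (path_matroid m r P Q))"

end

(*
Let A j and B j be the numbers of North steps among the first j steps of Q and of P. The sets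
N_i are intervals none of which contains another, so in Hall's condition for I it suffices to test
the parts of I in intervals: I is independent in M[P,Q] iff card (I \<inter> {u<..v}) + B u \<le> A v
for all u \<le> v. Restricting to an initial segment drops inequalities, and adding the element i
only adds those with v = i. If A rises at step i, they hold automatically (isthmus). If A does not
rise and A (i - 1) = B (i - 1), they fail for {i} (loop). Otherwise let h be largest such that
{h..i} is dependent; then i is added by the principal extension generated by {h..i-1}.

Conversely, A and B are built step by step, with A = B at the current endpoint. When i is added by
a principal extension generated by {h..i-1}, independence of {h..i-1} forces B to rise at each of
the steps h, ..., i-1, and it suffices to postpone these rises by one step.

On independent sets, the principal extension by x that is generated by the closure of S reads: for
I independent, I + x is independent iff I + e is independent for some e in S - I.
*)

theory Submission
  imports Defs
begin

section \<open>Closures and single-element extensions\<close>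

lemma ground_restrict_to: "ground (restrict_to M X) = ground M \<inter> X"
  by (simp add: restrict_to_def)

lemma indep_restrict_to_iff: "I \<in> indep (restrict_to M X) \<longleftrightarrow> I \<in> indep M \<and> I \<subseteq> X"
  by (simp add: restrict_to_def)

section \<open>Rank, closure and flats through maximal independent subsets\<close>

context matroid
begin

lemma finite_indep: "I \<in> indep M \<Longrightarrow> finite I"
  using indep_subset_ground finite_ground finite_subset by blast

lemma finite_indeps: "finite (indep M)"
  by (rule finite_subset[of _ "Pow (ground M)"]) (use indep_subset_ground finite_ground in auto)

lemma card_le_rank:
  assumes "I \<in> indep M" "I \<subseteq> X"
  shows "card I \<le> rank M X"
  unfolding rank_def using finite_indeps assms by (intro Max_ge) auto

text \<open>By augmentation, an independent subset of \<open>X\<close> that no single element of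
  \<open>X\<close> extends already has maximum size. So any maximal \<open>I\<close> computes the
  rank.\<close>

lemma rank_eq_card:
  assumes "I \<in> indep M" "I \<subseteq> X" "\<forall>e \<in> X - I. insert e I \<notin> indep M"
  shows "rank M X = card I"
  unfolding rank_def
proof (rule Max_eqI)
  show "finite {card I |I. I \<in> indep M \<and> I \<subseteq> X}"
    using finite_indeps by simp
  show "card I \<in> {card I |I. I \<in> indep M \<and> I \<subseteq> X}"
    using assms by blast
  fix c assume "c \<in> {card I |I. I \<in> indep M \<and> I \<subseteq> X}"
  then obtain K where K: "K \<in> indep M" "K \<subseteq> X" "c = card K" by blast
  show "c \<le> card I"
  proof (rule ccontr)
    assume "\<not> c \<le> card I"
    then obtain y where "y \<in> K - I" "insert y I \<in> indep M"
      using augment[OF assms(1) K(1)] K(3) by auto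
    then show False using assms(3) K(2) by blast
  qed
qed

lemma extend_to_maximal:
  assumes "I \<in> indep M" "I \<subseteq> X"
  obtains B where "B \<in> indep M" "I \<subseteq> B" "B \<subseteq> X"
    "\<forall>e \<in> X - B. insert e B \<notin> indep M"
proof -
  define F where "F = {B \<in> indep M. I \<subseteq> B \<and> B \<subseteq> X}"
  have "finite F" "I \<in> F" using finite_indeps assms by (simp_all add: F_def)
  then obtain B where B: "B \<in> F" "\<forall>C \<in> F. B \<subseteq> C \<longrightarrow> B = C"
    using finite_has_maximal2[of F I] by blast
  have "insert e B \<notin> indep M" if "e \<in> X - B" for e
  proof
    assume "insert e B \<in> indep M"
    then have "insert e B \<in> F" using B(1) that by (auto simp: F_def)
    then have "B = insert e B" using B(2) by blast
    then show False using that by blast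
  qed
  then show thesis using that[of B] B(1) by (simp add: F_def)
qed

lemma maximal_exists:
  obtains B where "B \<in> indep M" "B \<subseteq> X" "\<forall>e \<in> X - B. insert e B \<notin> indep M"
proof (rule extend_to_maximal[OF empty_indep empty_subsetI])
  fix B assume "B \<in> indep M" "B \<subseteq> X" "\<forall>e \<in> X - B. insert e B \<notin> indep M"
  then show thesis by (rule that)
qed

text \<open>One maximal independent subset \<open>I\<close> of \<open>X\<close> decides membership
  in the closure: either \<open>I\<close> is still maximal in \<open>insert y X\<close>, or
  \<open>insert y I\<close> shows that the rank goes up. This replaces rank computations from here
  on.\<close>

lemma mem_closure_iff:
  assumes "I \<in> indep M" "I \<subseteq> X" "\<forall>e \<in> X - I. insert e I \<notin> indep M"
  shows "y \<in> closure M X \<longleftrightarrow> y \<in> ground M \<and> (y \<in> I \<or> insert y I \<notin> indep M)"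
proof (cases "y \<in> I \<or> insert y I \<notin> indep M")
  case True
  have "rank M (insert y X) = card I"
  proof (rule rank_eq_card)
    show "I \<subseteq> insert y X" using assms(2) by blast
    show "\<forall>e \<in> insert y X - I. insert e I \<notin> indep M"
      using assms(3) True by blast
  qed fact
  then show ?thesis using True rank_eq_card[OF assms] by (simp add: closure_def)
next
  case False
  then have "card (insert y I) \<le> rank M (insert y X)"
    using assms(2) by (intro card_le_rank) blast+
  then have "rank M (insert y X) \<noteq> rank M X"
    using False rank_eq_card[OF assms] finite_indep[OF assms(1)] by simp
  then show ?thesis using False by (simp add: closure_def)
qed

lemma mem_closure_indep_iff:
  "I \<in> indep M \<Longrightarrow> y \<in> closure M I \<longleftrightarrow> y \<in> ground M \<and> (y \<in> I \<or> insert y I \<notin> indep M)"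
  by (rule mem_closure_iff) auto

lemma subset_closure:
  assumes "X \<subseteq> ground M"
  shows "X \<subseteq> closure M X"
  using assms by (auto simp: closure_def insert_absorb)

text \<open>A maximal \<open>I\<close> in \<open>X\<close> grows to a maximal \<open>K\<close> in
  \<open>Y\<close>. If \<open>y\<close> could be added to \<open>K\<close>, it could be added to the
  smaller \<open>I\<close>.\<close>

lemma closure_mono:
  assumes "X \<subseteq> Y"
  shows "closure M X \<subseteq> closure M Y"
proof
  fix y assume y: "y \<in> closure M X"
  obtain I where I: "I \<in> indep M" "I \<subseteq> X" "\<forall>e \<in> X - I. insert e I \<notin> indep M"
    using maximal_exists[of X] .
  have "I \<subseteq> Y" using I(2) assms by blast
  obtain K where K: "K \<in> indep M" "I \<subseteq> K" "K \<subseteq> Y" "\<forall>e \<in> Y - K. insert e K \<notin> indep M"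
    using extend_to_maximal[OF I(1) \<open>I \<subseteq> Y\<close>] .
  have "insert y I \<in> indep M" if "insert y K \<in> indep M"
    using that by (rule indep_subset) (rule insert_mono[OF K(2)])
  moreover have "y \<in> ground M \<and> (y \<in> I \<or> insert y I \<notin> indep M)"
    using y mem_closure_iff[OF I] by simp
  ultimately have "y \<in> ground M \<and> (y \<in> K \<or> insert y K \<notin> indep M)"
    using K(2) by auto
  then show "y \<in> closure M Y" using mem_closure_iff[OF K(1,3,4)] by simp
qed

text \<open>A maximal independent subset of \<open>X\<close> stays maximal in the closure of
  \<open>X\<close>, so taking the closure twice applies the same test twice.\<close>

lemma flat_closure:
  assumes "X \<subseteq> ground M"
  shows "flat M (closure M X)"
proof -
  obtain I where I: "I \<in> indep M" "I \<subseteq> X" "\<forall>e \<in> X - I. insert e I \<notin> indep M"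
    using maximal_exists[of X] .
  have sub: "I \<subseteq> closure M X" using subset_closure[OF assms] I(2) by blast
  have max: "\<forall>e \<in> closure M X - I. insert e I \<notin> indep M"
    using mem_closure_iff[OF I] by auto
  have "closure M (closure M X) = closure M X"
    by (intro set_eqI) (simp add: mem_closure_iff[OF I(1) sub max] mem_closure_iff[OF I])
  moreover have "closure M X \<subseteq> ground M" by (auto simp: closure_def)
  ultimately show ?thesis by (simp add: flat_def)
qed

text \<open>Lets the generating flat of a principal extension be replaced by a set that spans
  it.\<close>

lemma closure_subset_flat_iff:
  assumes "S \<subseteq> ground M" "flat M G"
  shows "closure M S \<subseteq> G \<longleftrightarrow> S \<subseteq> G"
proof
  show "S \<subseteq> G" if "closure M S \<subseteq> G" using that subset_closure[OF assms(1)] by (rule order_trans[rotated])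
  show "closure M S \<subseteq> G" if "S \<subseteq> G" using closure_mono[OF that] assms(2) by (simp add: flat_def)
qed

lemma subset_closure_indep_iff:
  assumes "I \<in> indep M" "S \<subseteq> ground M"
  shows "S \<subseteq> closure M I \<longleftrightarrow> \<not> (\<exists>e \<in> S - I. insert e I \<in> indep M)"
  using assms mem_closure_indep_iff[OF assms(1)] by blast

lemma matroid_restrict_to: "matroid (restrict_to M X)"
proof
  show "finite (ground (restrict_to M X))" using finite_ground by (simp add: ground_restrict_to)
  show "{} \<in> indep (restrict_to M X)" using empty_indep by (simp add: indep_restrict_to_iff)
next
  fix I assume "I \<in> indep (restrict_to M X)"
  then show "I \<subseteq> ground (restrict_to M X)"
    using indep_subset_ground[of I] by (simp add: ground_restrict_to indep_restrict_to_iff)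
next
  fix I K assume "I \<in> indep (restrict_to M X)" "K \<subseteq> I"
  then show "K \<in> indep (restrict_to M X)"
    using indep_subset[of I K] by (auto simp: indep_restrict_to_iff)
next
  fix I K
  assume I: "I \<in> indep (restrict_to M X)" and K: "K \<in> indep (restrict_to M X)" and "card I < card K"
  then obtain y where "y \<in> K - I" "insert y I \<in> indep M"
    using augment[of I K] unfolding indep_restrict_to_iff by blast
  then show "\<exists>y \<in> K - I. insert y I \<in> indep (restrict_to M X)"
    using I K unfolding indep_restrict_to_iff by blast
qed

end

section \<open>Extensions by a single element, tested on independent sets\<close>

lemma extension_byD:
  assumes "extension_by M x M'"
  shows "matroid M'" "x \<notin> ground M" "ground M' = insert x (ground M)"
    "restrict_to M' (ground M) = M"
  using assms unfolding extension_by_def by - (elim conjE, assumption)+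

lemma indep_iff_of_extension: "extension_by M x M' \<Longrightarrow> I \<in> indep M \<longleftrightarrow> I \<in> indep M' \<and> I \<subseteq> ground M"
  using indep_restrict_to_iff[of I M' "ground M"] extension_byD(4)[of M x M'] by simp

lemma indep_extension_iff:
  "extension_by M x M' \<Longrightarrow> I \<subseteq> ground M \<Longrightarrow> I \<in> indep M' \<longleftrightarrow> I \<in> indep M"
  using indep_iff_of_extension[of M x M' I] by simp

text \<open>Sets inside \<open>ground M\<close> have the same independence in \<open>M\<close> and
  \<open>M'\<close>, so \<open>I\<close> is still maximal in \<open>G\<close> within
  \<open>M'\<close> and decides whether \<open>G\<close> spans \<open>x\<close>.\<close>

lemma mem_closure_extension_iff:
  assumes "extension_by M x M'" "I \<in> indep M" "I \<subseteq> G" "G \<subseteq> ground M"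
    and "\<forall>e \<in> G - I. insert e I \<notin> indep M"
  shows "x \<in> closure M' G \<longleftrightarrow> insert x I \<notin> indep M'"
proof -
  interpret M': matroid M' using extension_byD(1)[OF assms(1)] .
  have "x \<in> closure M' G \<longleftrightarrow> x \<in> ground M' \<and> (x \<in> I \<or> insert x I \<notin> indep M')"
  proof (rule M'.mem_closure_iff)
    show "I \<in> indep M'" "I \<subseteq> G"
      using assms(2-4) indep_extension_iff[OF assms(1), of I] by blast+
    show "\<forall>e \<in> G - I. insert e I \<notin> indep M'"
    proof
      fix e assume e: "e \<in> G - I"
      then have "insert e I \<subseteq> ground M" using assms(3,4) by blast
      then show "insert e I \<notin> indep M'"
        using bspec[OF assms(5) e] indep_extension_iff[OF assms(1)] by simp
    qed
  qed
  moreover have "x \<in> ground M'" "x \<notin> I"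
    using extension_byD(2,3)[OF assms(1)] assms(3,4) by blast+
  ultimately show ?thesis by argo
qed

text \<open>Every flat is the closure of an independent set \<open>I\<close>. Such a flat spans
  \<open>x\<close> iff \<open>insert x I\<close> is dependent, and it contains \<open>S\<close> iff
  no element of \<open>S - I\<close> can be added to \<open>I\<close>. The condition on flats thus
  becomes one on independent sets.\<close>

lemma principal_extension_closure_iff:
  assumes "matroid M" "extension_by M x M'" "S \<subseteq> ground M"
  shows "principal_extension M (closure M S) x M' \<longleftrightarrow>
    (\<forall>I \<in> indep M. insert x I \<in> indep M' \<longleftrightarrow> (\<exists>e \<in> S - I. insert e I \<in> indep M))"
    (is "?principal \<longleftrightarrow> ?exchange")
proof
  interpret matroid M by fact
  assume principal: ?principal
  show ?exchange
  proof
    fix I assume I: "I \<in> indep M"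
    let ?G = "closure M I"
    have ground: "I \<subseteq> ground M" using I indep_subset_ground by blast
    have "?G \<subseteq> ground M" by (auto simp: closure_def)
    then have "x \<in> closure M' ?G \<longleftrightarrow> insert x I \<notin> indep M'"
      by (rule mem_closure_extension_iff[OF assms(2) I subset_closure[OF ground]])
        (use mem_closure_indep_iff[OF I] in auto)
    moreover have "x \<in> closure M' ?G \<longleftrightarrow> closure M S \<subseteq> ?G"
      using principal flat_closure[OF ground] by (simp add: principal_extension_def)
    ultimately show "insert x I \<in> indep M' \<longleftrightarrow> (\<exists>e \<in> S - I. insert e I \<in> indep M)"
      using closure_subset_flat_iff[OF assms(3) flat_closure[OF ground]]
        subset_closure_indep_iff[OF I assms(3)] by argo
  qed
next
  interpret matroid M by fact
  assume exchange: ?exchange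
  have "x \<in> closure M' G \<longleftrightarrow> closure M S \<subseteq> G" if G: "flat M G" for G
  proof -
    obtain I where I: "I \<in> indep M" "I \<subseteq> G" "\<forall>e \<in> G - I. insert e I \<notin> indep M"
      using maximal_exists[of G] .
    have "G \<subseteq> ground M" "closure M G = G" using G by (simp_all add: flat_def)
    have "x \<in> closure M' G \<longleftrightarrow> insert x I \<notin> indep M'"
      by (rule mem_closure_extension_iff[OF assms(2) I(1,2) \<open>G \<subseteq> ground M\<close> I(3)])
    \<comment> \<open>Both closures are decided by the same set \<open>I\<close>, which therefore
      spans the flat \<open>G\<close>.\<close>
    moreover have "closure M I = closure M G"
      by (intro set_eqI) (simp only: mem_closure_iff[OF I] mem_closure_indep_iff[OF I(1)])
    then have "closure M I = G" using \<open>closure M G = G\<close> by simp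
    ultimately show ?thesis
      using bspec[OF exchange I(1)] closure_subset_flat_iff[OF assms(3) G]
        subset_closure_indep_iff[OF I(1) assms(3)] by argo
  qed
  then show ?principal
    using assms(2) flat_closure[OF assms(3)] by (simp add: principal_extension_def)
qed

text \<open>An independent set extends to a basis, and the basis contains the isthmus. Conversely, a
  basis of \<open>M'\<close> that misses \<open>x\<close> is independent in \<open>M\<close>, so
  adding \<open>x\<close> would contradict its maximality.\<close>

lemma adds_isthmus_iff:
  assumes "extension_by M x M'"
  shows "adds_isthmus M x M' \<longleftrightarrow> (\<forall>I \<in> indep M. insert x I \<in> indep M')" (is "?isthmus \<longleftrightarrow> ?all")
proof
  interpret M': matroid M' using extension_byD(1)[OF assms] .
  note indep = indep_iff_of_extension[OF assms]
  note ground = extension_byD(3)[OF assms]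
  show ?all if ?isthmus
  proof
    fix I assume "I \<in> indep M"
    then have I: "I \<in> indep M'" "I \<subseteq> ground M'" using indep[of I] ground by auto
    obtain B where B: "B \<in> indep M'" "I \<subseteq> B" "B \<subseteq> ground M'"
      "\<forall>e \<in> ground M' - B. insert e B \<notin> indep M'"
      using M'.extend_to_maximal[OF I] .
    have "basis M' B"
      unfolding basis_def
    proof (intro conjI ballI impI B(1))
      fix C assume C: "C \<in> indep M'" "B \<subseteq> C"
      show "C = B"
      proof (rule ccontr)
        assume "C \<noteq> B"
        then obtain e where "e \<in> C - B" using C(2) by blast
        then have "e \<in> ground M' - B" "insert e B \<in> indep M'"
          using C(2) M'.indep_subset_ground[OF C(1)] M'.indep_subset[OF C(1), of "insert e B"]
          by blast+
        then show False using B(4) by blast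
      qed
    qed
    then have "x \<in> B" using \<open>?isthmus\<close> unfolding adds_isthmus_def isthmus_def by blast
    then show "insert x I \<in> indep M'" using B(2) M'.indep_subset[OF B(1), of "insert x I"] by blast
  qed
  show ?isthmus if ?all
  proof -
    have "x \<in> B" if "basis M' B" for B
    proof (rule ccontr)
      assume "x \<notin> B"
      moreover have B: "B \<in> indep M'" using that unfolding basis_def by (rule conjunct1)
      ultimately have "B \<in> indep M" using indep[of B] ground M'.indep_subset_ground[OF B] by auto
      then have "insert x B \<in> indep M'" using \<open>?all\<close> by blast
      then show False using that \<open>x \<notin> B\<close> unfolding basis_def by blast
    qed
    then show ?thesis using assms ground by (simp add: adds_isthmus_def isthmus_def)
  qed
qed

section \<open>Independence as a family of counting inequalities\<close>

text \<open>The height functions of lattice paths with \<open>n\<close> steps: \<open>C j\<close>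
  counts the North steps among the first \<open>j\<close>. Values beyond \<open>n\<close> are free,
  so that a function can be extended by updating it at \<open>Suc n\<close>.\<close>

definition unit_steps :: "nat \<Rightarrow> (nat \<Rightarrow> nat) \<Rightarrow> bool" where
  "unit_steps n C \<longleftrightarrow> C 0 = 0 \<and> (\<forall>j < n. C (Suc j) = C j \<or> C (Suc j) = Suc (C j))"

text \<open>Hall's condition on intervals: the elements of \<open>I\<close> in
  \<open>{u<..v}\<close> compete for the labels in \<open>{B u<..A v}\<close>. The additive form
  avoids truncated subtraction, and the case \<open>u = v\<close> includes
  \<open>B v \<le> A v\<close>.\<close>

definition fits :: "nat \<Rightarrow> (nat \<Rightarrow> nat) \<Rightarrow> (nat \<Rightarrow> nat) \<Rightarrow> nat set \<Rightarrow> bool" where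
  "fits n B A I \<longleftrightarrow> (\<forall>v \<le> n. \<forall>u \<le> v. card (I \<inter> {u<..v}) + B u \<le> A v)"

text \<open>\<open>J\<close> stands for independence of sets of positions in an ordering, and
  position \<open>Suc p\<close> is the new one. The disjuncts are the isthmus, the loop and the
  principal extension, the last in its form on independent sets.\<close>

definition elementary_step :: "(nat set \<Rightarrow> bool) \<Rightarrow> nat \<Rightarrow> bool" where
  "elementary_step J p \<longleftrightarrow>
     (\<forall>Y \<subseteq> {1..p}. J Y \<longrightarrow> J (insert (Suc p) Y)) \<or> \<not> J {Suc p} \<or>
     (\<exists>h. 1 \<le> h \<and> h \<le> p \<and> J {h..p} \<and>
       (\<forall>Y \<subseteq> {1..p}. J Y \<longrightarrow> (J (insert (Suc p) Y) \<longleftrightarrow> (\<exists>e \<in> {h..p} - Y. J (insert e Y)))))"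

section \<open>Counting inequalities on initial segments\<close>

lemma unit_steps_mono:
  assumes "unit_steps n C" "i \<le> j" "j \<le> n"
  shows "C i \<le> C j \<and> C j \<le> C i + (j - i)"
  using assms(2,3)
proof (induction j rule: dec_induct)
  case (step k)
  then have "C (Suc k) = C k \<or> C (Suc k) = Suc (C k)" using assms(1) by (simp add: unit_steps_def)
  then show ?case using step by auto
qed simp

lemma unit_steps_le: "unit_steps n C \<Longrightarrow> j \<le> n \<Longrightarrow> C j \<le> j"
  using unit_steps_mono[of n C 0 j] by (simp add: unit_steps_def)

lemma unit_steps_antimono: "unit_steps n C \<Longrightarrow> m \<le> n \<Longrightarrow> unit_steps m C"
  by (simp add: unit_steps_def)

lemma card_Int_Ioc_le: "card (Y \<inter> {u<..v}) \<le> v - (u::nat)"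
  using card_mono[of "{u<..v}" "Y \<inter> {u<..v}"] by simp

lemma fitsD: "fits n B A I \<Longrightarrow> v \<le> n \<Longrightarrow> u \<le> v \<Longrightarrow> card (I \<inter> {u<..v}) + B u \<le> A v"
  by (simp add: fits_def)

lemma fits_antimono: "fits n B A Y \<Longrightarrow> m \<le> n \<Longrightarrow> fits m B A Y"
  by (simp add: fits_def)

text \<open>For \<open>Y\<close> inside \<open>{1..p}\<close>, the inequalities with
  \<open>v > p\<close> are consequences: if \<open>u \<le> p\<close>, replace \<open>v\<close> by
  \<open>p\<close> and use that \<open>A\<close> is monotone; if \<open>u > p\<close>, the interval
  misses \<open>Y\<close> and \<open>B \<le> A\<close> suffices.\<close>

lemma fits_iff_restrict:
  assumes "unit_steps n A" "\<And>j. j \<le> n \<Longrightarrow> B j \<le> A j" "p \<le> n" "Y \<subseteq> {1..p}"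
  shows "fits n B A Y \<longleftrightarrow> fits p B A Y"
proof
  assume fits: "fits p B A Y"
  show "fits n B A Y"
    unfolding fits_def
  proof (intro allI impI)
    fix u v assume "v \<le> n" "u \<le> v"
    show "card (Y \<inter> {u<..v}) + B u \<le> A v"
    proof (cases "u \<le> p")
      case True
      define w where "w = min v p"
      have "Y \<inter> {u<..v} = Y \<inter> {u<..w}" using assms(4) by (auto simp: w_def)
      moreover have "card (Y \<inter> {u<..w}) + B u \<le> A w"
        using fits True \<open>u \<le> v\<close> by (simp add: fits_def w_def)
      moreover have "A w \<le> A v" using unit_steps_mono[OF assms(1), of w v] \<open>v \<le> n\<close> by (simp add: w_def)
      ultimately show ?thesis by simp
    next
      case False
      then have "Y \<inter> {u<..v} = {}" using assms(4) by auto
      then show ?thesis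
        using assms(2)[of u] unit_steps_mono[OF assms(1), of u v] \<open>u \<le> v\<close> \<open>v \<le> n\<close> by simp
    qed
  qed
qed (use assms(3) fits_antimono in blast)

text \<open>Only the inequalities with \<open>v = Suc p\<close> see the new element, and among these
  the one with \<open>u = Suc p\<close> is the hypothesis on \<open>B\<close> and
  \<open>A\<close>.\<close>

lemma fits_insert_Suc_iff:
  assumes "Y \<subseteq> {1..p}" "B (Suc p) \<le> A (Suc p)"
  shows "fits (Suc p) B A (insert (Suc p) Y) \<longleftrightarrow>
    fits p B A Y \<and> (\<forall>u \<le> p. Suc (card (Y \<inter> {u<..p}) + B u) \<le> A (Suc p))"
proof -
  have old: "insert (Suc p) Y \<inter> {u<..v} = Y \<inter> {u<..v}" if "v \<le> p" for u v using that by auto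
  have new: "card (insert (Suc p) Y \<inter> {u<..Suc p}) = Suc (card (Y \<inter> {u<..p}))" if "u \<le> p" for u
  proof -
    have "insert (Suc p) Y \<inter> {u<..Suc p} = insert (Suc p) (Y \<inter> {u<..p})" using that assms(1) by auto
    then show ?thesis by simp
  qed
  have "fits (Suc p) B A (insert (Suc p) Y) \<longleftrightarrow> fits p B A (insert (Suc p) Y) \<and>
      (\<forall>u \<le> Suc p. card (insert (Suc p) Y \<inter> {u<..Suc p}) + B u \<le> A (Suc p))"
    by (auto simp: fits_def le_Suc_eq)
  also have "fits p B A (insert (Suc p) Y) \<longleftrightarrow> fits p B A Y" by (simp add: fits_def old)
  also have "(\<forall>u \<le> Suc p. card (insert (Suc p) Y \<inter> {u<..Suc p}) + B u \<le> A (Suc p)) \<longleftrightarrow>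
      (\<forall>u \<le> p. Suc (card (Y \<inter> {u<..p}) + B u) \<le> A (Suc p))"
  proof -
    have "card (insert (Suc p) Y \<inter> {Suc p<..Suc p}) + B (Suc p) \<le> A (Suc p)"
      using assms(2) by simp
    moreover have "card (insert (Suc p) Y \<inter> {u<..Suc p}) + B u = Suc (card (Y \<inter> {u<..p}) + B u)"
      if "u \<le> p" for u
      using new[OF that] by simp
    ultimately show ?thesis using le_Suc_eq[of _ p] by metis
  qed
  finally show ?thesis .
qed

text \<open>The equation for \<open>A p\<close> says that \<open>{h..p}\<close> is tight from
  \<open>u = h - 1\<close>, while from \<open>u \<ge> h\<close> there is always room for one more
  element. Hence the new element fits iff some gap of \<open>Y\<close> in \<open>{h..p}\<close> can
  be filled: filling a gap raises every count up to \<open>p\<close> that starts at some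
  \<open>u < h\<close>, just as the new element does at \<open>Suc p\<close>.\<close>

lemma fits_insert_Suc_iff_exchange:
  assumes A: "unit_steps p A" "A (Suc p) = A p" and B: "unit_steps p B" "B (Suc p) \<le> A (Suc p)"
    and h: "1 \<le> h" "h \<le> p" "A p = Suc p - h + B (h - 1)"
    and slack: "\<And>u. h \<le> u \<Longrightarrow> u \<le> p \<Longrightarrow> p - u + B u < A p"
    and Y: "Y \<subseteq> {1..p}" "fits p B A Y"
  shows "fits (Suc p) B A (insert (Suc p) Y) \<longleftrightarrow> (\<exists>e \<in> {h..p} - Y. fits p B A (insert e Y))"
proof
  have fin: "finite Y" using Y(1) finite_subset by blast
  assume "fits (Suc p) B A (insert (Suc p) Y)"
  then have strict: "Suc (card (Y \<inter> {u<..p}) + B u) \<le> A p" if "u \<le> p" for u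
    using that fits_insert_Suc_iff[of Y p B A] Y(1) B(2) A(2) by simp
  \<comment> \<open>If \<open>Y\<close> contained all of \<open>{h..p}\<close>, tightness from
    \<open>h - 1\<close> would leave no room for the new element.\<close>
  have "{h..p} - Y \<noteq> {}"
  proof
    assume "{h..p} - Y = {}"
    then have "Y \<inter> {h - 1<..p} = {h..p}" using h by auto
    moreover have "h - 1 \<le> p" using h by simp
    ultimately have "Suc (Suc p - h + B (h - 1)) \<le> A p" using strict[of "h - 1"] by simp
    then show False using h by simp
  qed
  \<comment> \<open>The last gap is chosen because \<open>Y\<close> is full after it: the strict
    inequality at \<open>p\<close> can then be carried back to any \<open>v \<ge> e\<close>, since
    each step back removes one element and lowers \<open>A\<close> by at most one.\<close>
  define e where "e = Max ({h..p} - Y)"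
  have e: "e \<in> {h..p} - Y" unfolding e_def by (rule Max_in) (use \<open>{h..p} - Y \<noteq> {}\<close> in auto)
  have above: "d \<in> Y" if "e < d" "d \<le> p" for d
  proof (rule ccontr)
    assume "d \<notin> Y"
    then have "d \<le> e" unfolding e_def using that e by (intro Max_ge) auto
    then show False using that by simp
  qed
  have "fits p B A (insert e Y)"
    unfolding fits_def
  proof (intro allI impI)
    fix u v assume uv: "v \<le> p" "u \<le> v"
    have old: "card (Y \<inter> {u<..v}) + B u \<le> A v" using Y(2) uv by (simp add: fits_def)
    show "card (insert e Y \<inter> {u<..v}) + B u \<le> A v"
    proof (cases "u < e \<and> e \<le> v")
      case False
      then have "insert e Y \<inter> {u<..v} = Y \<inter> {u<..v}" by auto
      then show ?thesis using old by simp
    next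
      case True
      have "Y \<inter> {u<..p} = (Y \<inter> {u<..v}) \<union> {v<..p}" using above True uv by auto
      moreover have "(Y \<inter> {u<..v}) \<inter> {v<..p} = {}" by auto
      ultimately have "card (Y \<inter> {u<..p}) = card (Y \<inter> {u<..v}) + (p - v)"
        by (simp add: card_Un_disjoint fin)
      moreover have "A p \<le> A v + (p - v)" using unit_steps_mono[OF A(1)] uv by blast
      moreover have "insert e Y \<inter> {u<..v} = insert e (Y \<inter> {u<..v})" using True by auto
      ultimately show ?thesis using strict[of u] uv e fin by simp
    qed
  qed
  then show "\<exists>e \<in> {h..p} - Y. fits p B A (insert e Y)" using e by blast
next
  have fin: "finite Y" using Y(1) finite_subset by blast
  assume "\<exists>e \<in> {h..p} - Y. fits p B A (insert e Y)"
  then obtain e where e: "e \<in> {h..p} - Y" "fits p B A (insert e Y)" by blast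
  have "Suc (card (Y \<inter> {u<..p}) + B u) \<le> A (Suc p)" if "u \<le> p" for u
  proof (cases "u < h")
    case True
    have "insert e Y \<inter> {u<..p} = insert e (Y \<inter> {u<..p})" using True e by auto
    then have "card (insert e Y \<inter> {u<..p}) = Suc (card (Y \<inter> {u<..p}))" using e fin by simp
    then show ?thesis using fitsD[OF e(2) _ that] A(2) by simp
  next
    case False
    then show ?thesis using slack[of u] that card_Int_Ioc_le[of Y u p] A(2) by simp
  qed
  then show "fits (Suc p) B A (insert (Suc p) Y)"
    using fits_insert_Suc_iff[of Y p B A] Y B(2) by simp
qed

text \<open>The inequalities at \<open>v = p\<close> are the tight one and the slack ones. Moving
  \<open>v\<close> back towards \<open>h\<close> removes one element per step and lowers
  \<open>A\<close> by at most one; below \<open>h\<close> only \<open>B \<le> A\<close>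
  remains.\<close>

lemma fits_atLeastAtMost:
  assumes A: "unit_steps p A" and B: "unit_steps p B"
    and h: "1 \<le> h" "h \<le> p" "A p = Suc p - h + B (h - 1)"
    and slack: "\<And>u. h \<le> u \<Longrightarrow> u \<le> p \<Longrightarrow> p - u + B u < A p"
    and le: "\<And>j. j \<le> p \<Longrightarrow> B j \<le> A j"
  shows "fits p B A {h..p}"
  unfolding fits_def
proof (intro allI impI)
  fix u v assume uv: "v \<le> p" "u \<le> v"
  have Av: "A p \<le> A v + (p - v)" using unit_steps_mono[OF A] uv by blast
  show "card ({h..p} \<inter> {u<..v}) + B u \<le> A v"
  proof (cases "h \<le> u")
    case True
    then have "{h..p} \<inter> {u<..v} = {u<..v}" using uv by auto
    then show ?thesis using slack[of u] True uv Av by simp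
  next
    case False
    show ?thesis
    proof (cases "h \<le> v")
      case True
      have "{h..p} \<inter> {u<..v} = {h..v}" using False uv by auto
      moreover have "B u \<le> B (h - 1)"
        using unit_steps_mono[OF B, of u "h - 1"] False h by simp
      ultimately show ?thesis using Av h True uv by simp
    next
      case 2: False
      then have "{h..p} \<inter> {u<..v} = {}" by auto
      then show ?thesis using le[of u] unit_steps_mono[OF A, of u v] uv by simp
    qed
  qed
qed

lemma elementary_step_fits:
  assumes A: "unit_steps n A" and B: "unit_steps n B" and le: "\<And>j. j \<le> n \<Longrightarrow> B j \<le> A j"
    and J: "\<And>Y. Y \<subseteq> {1..n} \<Longrightarrow> J Y \<longleftrightarrow> fits n B A Y" and "p < n"
  shows "elementary_step J p"
proof -
  have Jq: "J Y \<longleftrightarrow> fits q B A Y" if "Y \<subseteq> {1..q}" "q \<le> n" for Y q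
  proof -
    have "Y \<subseteq> {1..n}" using that by force
    then show ?thesis using fits_iff_restrict[OF A le that(2,1)] J by blast
  qed
  have Jp: "J Y \<longleftrightarrow> fits p B A Y" if "Y \<subseteq> {1..p}" for Y
    using Jq that \<open>p < n\<close> by simp
  have Jnew: "J (insert (Suc p) Y) \<longleftrightarrow> fits (Suc p) B A (insert (Suc p) Y)" if "Y \<subseteq> {1..p}" for Y
    using that \<open>p < n\<close> by (intro Jq) auto
  have Ap: "unit_steps p A" and Bp: "unit_steps p B"
    using A B \<open>p < n\<close> unit_steps_antimono less_imp_le by blast+
  have leS: "B (Suc p) \<le> A (Suc p)" using le \<open>p < n\<close> by simp
  have "A (Suc p) = Suc (A p) \<or> A (Suc p) = A p" using A \<open>p < n\<close> by (auto simp: unit_steps_def)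
  then consider (up) "A (Suc p) = Suc (A p)" | (loop) "A (Suc p) = A p" "A p = B p"
    | (free) "A (Suc p) = A p" "B p < A p" using le[of p] \<open>p < n\<close> by fastforce
  then show ?thesis
  proof cases
    case up
    have "J (insert (Suc p) Y)" if "Y \<subseteq> {1..p}" "J Y" for Y
      using that Jp[of Y] Jnew[of Y] fits_insert_Suc_iff[of Y p B A] leS up
      by (auto simp: fits_def)
    then show ?thesis by (simp add: elementary_step_def)
  next
    case loop
    have "\<not> fits (Suc p) B A {Suc p}"
      using fits_insert_Suc_iff[of "{}" p B A] leS loop by auto
    then have "\<not> J {Suc p}" using Jnew[of "{}"] by simp
    then show ?thesis by (simp add: elementary_step_def)
  next
    case free
    have "A p \<le> p" using unit_steps_le[OF Ap] by simp
    \<comment> \<open>As \<open>A (Suc p) = A p\<close>, these are the \<open>h\<close> for which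
      \<open>{h..Suc p}\<close> violates the inequality with \<open>u = h - 1\<close> and
      \<open>v = Suc p\<close>. The bound \<open>A p \<le> p\<close> puts 1 among them.\<close>
    define H where "H = {h. 1 \<le> h \<and> h \<le> p \<and> A p \<le> Suc p - h + B (h - 1)}"
    have fin: "finite H" by (rule finite_subset[of _ "{..p}"]) (auto simp: H_def)
    have "1 \<in> H" using free \<open>A p \<le> p\<close> by (simp add: H_def)
    define h where "h = Max H"
    have hH: "h \<in> H" unfolding h_def using fin \<open>1 \<in> H\<close> Max_in by blast
    then have h: "1 \<le> h" "h \<le> p" "A p \<le> Suc p - h + B (h - 1)" by (auto simp: H_def)
    \<comment> \<open>For \<open>u < p\<close> this is maximality of \<open>h\<close>, applied to
      \<open>Suc u\<close>; for \<open>u = p\<close> it is the assumption that \<open>A\<close> and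
      \<open>B\<close> differ at \<open>p\<close>.\<close>
    have slack: "p - u + B u < A p" if "h \<le> u" "u \<le> p" for u
    proof (cases "u = p")
      case False
      have "Suc u \<notin> H"
      proof
        assume "Suc u \<in> H"
        then have "Suc u \<le> h" unfolding h_def using fin by simp
        then show False using that by simp
      qed
      then show ?thesis using False that by (simp add: H_def)
    qed (use free in simp)
    \<comment> \<open>Slack at \<open>h\<close> gives \<open>A p \<ge> Suc p - h + B h\<close>, and
      \<open>B h \<ge> B (h - 1)\<close>; the other inequality is \<open>h \<in> H\<close>.\<close>
    have eq: "A p = Suc p - h + B (h - 1)"
      using slack[of h] h unit_steps_mono[OF Bp, of "h - 1" h] by linarith
    have "J {h..p}"
      using Jp[of "{h..p}"] fits_atLeastAtMost[OF Ap Bp h(1,2) eq slack le] h \<open>p < n\<close> by simp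
    moreover have "J (insert (Suc p) Y) \<longleftrightarrow> (\<exists>e \<in> {h..p} - Y. J (insert e Y))"
      if Y: "Y \<subseteq> {1..p}" "J Y" for Y
    proof -
      have "J (insert e Y) \<longleftrightarrow> fits p B A (insert e Y)" if "e \<in> {h..p} - Y" for e
        using that Y h by (intro Jp) auto
      then show ?thesis
        using fits_insert_Suc_iff_exchange[OF Ap free(1) Bp leS h(1,2) eq slack Y(1)] Jnew Jp Y
        by auto
    qed
    ultimately show ?thesis using h unfolding elementary_step_def by blast
  qed
qed

text \<open>Induction on the number of positions. The invariant \<open>A n = B n\<close> lets the
  two paths end at the same point; in the step it also rules out the new element in the loop case
  and determines \<open>B\<close> on \<open>{h - 1..p}\<close> in the principal case.\<close>

lemma fits_of_elementary_steps:
  assumes hereditary: "\<And>Y Z. J Y \<Longrightarrow> Z \<subseteq> Y \<Longrightarrow> J Z" and "J {}"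
    and "\<And>p. p < n \<Longrightarrow> elementary_step J p"
  shows "\<exists>A B. unit_steps n A \<and> unit_steps n B \<and> (\<forall>j \<le> n. B j \<le> A j) \<and> A n = B n \<and>
    (\<forall>Y \<subseteq> {1..n}. J Y \<longleftrightarrow> fits n B A Y)"
  using assms(3)
proof (induction n)
  case 0
  show ?case
    by (rule exI[of _ "\<lambda>_. 0"], rule exI[of _ "\<lambda>_. 0"]) (simp add: unit_steps_def fits_def \<open>J {}\<close>)
next
  case (Suc p)
  have "\<exists>A B. unit_steps p A \<and> unit_steps p B \<and> (\<forall>j \<le> p. B j \<le> A j) \<and> A p = B p \<and>
      (\<forall>Y \<subseteq> {1..p}. J Y \<longleftrightarrow> fits p B A Y)"
    by (rule Suc.IH) (use Suc.prems in auto)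
  then obtain A B where A: "unit_steps p A" and B: "unit_steps p B"
    and le: "\<And>j. j \<le> p \<Longrightarrow> B j \<le> A j" and top: "A p = B p"
    and J: "\<And>Y. Y \<subseteq> {1..p} \<Longrightarrow> J Y \<longleftrightarrow> fits p B A Y"
    by blast
  \<comment> \<open>Work shared by the three cases. Sets that contain \<open>Suc p\<close> need
    checking only when the rest is independent, since otherwise both sides fail.\<close>
  have extend: ?case
    if A': "unit_steps (Suc p) A'" and B': "unit_steps (Suc p) B'"
      and le': "\<And>j. j \<le> Suc p \<Longrightarrow> B' j \<le> A' j" and top': "A' (Suc p) = B' (Suc p)"
      and old: "\<And>Y. Y \<subseteq> {1..p} \<Longrightarrow> fits p B' A' Y \<longleftrightarrow> fits p B A Y"
      and new: "\<And>Y. Y \<subseteq> {1..p} \<Longrightarrow> J Y \<Longrightarrow>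
        J (insert (Suc p) Y) \<longleftrightarrow> fits (Suc p) B' A' (insert (Suc p) Y)" for A' B'
  proof -
    have "J Y \<longleftrightarrow> fits (Suc p) B' A' Y" if Y: "Y \<subseteq> {1..Suc p}" for Y
    proof (cases "Suc p \<in> Y")
      case False
      then have "Y \<subseteq> {1..p}" using Y by (auto simp: le_Suc_eq)
      then show ?thesis using fits_iff_restrict[OF A' le', of p Y] old J by simp
    next
      case True
      define Z where "Z = Y - {Suc p}"
      have Z: "Y = insert (Suc p) Z" "Z \<subseteq> {1..p}" using True Y by (auto simp: Z_def le_Suc_eq)
      have "J Y \<Longrightarrow> J Z" using hereditary Z(1) by blast
      moreover have "fits (Suc p) B' A' Y \<Longrightarrow> J Z"
        using fits_insert_Suc_iff[of Z p B' A'] Z le' old J by simp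
      ultimately show ?thesis using new[OF Z(2)] Z(1) by blast
    qed
    then show ?thesis using A' B' le' top' by blast
  qed
  have "elementary_step J p" using Suc.prems by simp
  then consider (isthmus) "\<And>Y. Y \<subseteq> {1..p} \<Longrightarrow> J Y \<Longrightarrow> J (insert (Suc p) Y)"
    | (loop) "\<not> J {Suc p}"
    | (principal) h where "1 \<le> h" "h \<le> p" "J {h..p}" "\<And>Y. Y \<subseteq> {1..p} \<Longrightarrow> J Y \<Longrightarrow>
        J (insert (Suc p) Y) \<longleftrightarrow> (\<exists>e \<in> {h..p} - Y. J (insert e Y))"
    unfolding elementary_step_def by blast
  then show ?case
  proof cases
    case isthmus
    \<comment> \<open>Both paths go North, so each inequality at \<open>Suc p\<close> gains the unit
      that the new element uses.\<close>
    define A' where "A' = A(Suc p := Suc (A p))"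
    define B' where "B' = B(Suc p := Suc (A p))"
    have same: "fits p B' A' Y \<longleftrightarrow> fits p B A Y" for Y by (simp add: fits_def A'_def B'_def)
    show ?thesis
    proof (rule extend[of A' B'])
      show "J (insert (Suc p) Y) \<longleftrightarrow> fits (Suc p) B' A' (insert (Suc p) Y)"
        if Y: "Y \<subseteq> {1..p}" "J Y" for Y
      proof -
        have "fits p B A Y" using J Y by blast
        then have "Suc (card (Y \<inter> {u<..p}) + B u) \<le> Suc (A p)" if "u \<le> p" for u
          using that by (simp add: fits_def)
        then have "fits (Suc p) B' A' (insert (Suc p) Y)"
          using fits_insert_Suc_iff[of Y p B' A'] Y \<open>fits p B A Y\<close> same
          by (simp add: A'_def B'_def)
        then show ?thesis using isthmus Y by blast
      qed
    qed (use A B le top same in \<open>auto simp: unit_steps_def A'_def B'_def less_Suc_eq le_Suc_eq\<close>)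
  next
    case loop
    \<comment> \<open>Both paths go East. They meet at \<open>p\<close>, so the inequality with
      \<open>u = p\<close> excludes the new element.\<close>
    define A' where "A' = A(Suc p := A p)"
    define B' where "B' = B(Suc p := A p)"
    have same: "fits p B' A' Y \<longleftrightarrow> fits p B A Y" for Y by (simp add: fits_def A'_def B'_def)
    show ?thesis
    proof (rule extend[of A' B'])
      show "J (insert (Suc p) Y) \<longleftrightarrow> fits (Suc p) B' A' (insert (Suc p) Y)"
        if Y: "Y \<subseteq> {1..p}" "J Y" for Y
      proof -
        have "\<not> J (insert (Suc p) Y)" using loop hereditary by blast
        moreover have "\<not> Suc (card (Y \<inter> {p<..p}) + B' p) \<le> A' (Suc p)"
          using top by (simp add: A'_def B'_def)
        then have "\<not> fits (Suc p) B' A' (insert (Suc p) Y)"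
          using fits_insert_Suc_iff[of Y p B' A'] Y by (auto simp: A'_def B'_def)
        ultimately show ?thesis by blast
      qed
    qed (use A B le top same in \<open>auto simp: unit_steps_def A'_def B'_def less_Suc_eq le_Suc_eq\<close>)
  next
    case principal
    define A' where "A' = A(Suc p := A p)"
    \<comment> \<open>The rises of \<open>B\<close> at \<open>h, ..., p\<close> are postponed by one
      step: \<open>B' u = B u - 1\<close> for \<open>h \<le> u \<le> p\<close>, and
      \<open>B'\<close> is back at \<open>A p\<close> at \<open>Suc p\<close>.\<close>
    define B' where "B' = (\<lambda>u. if u < h then B u else A p + u - Suc p)"
    have "fits p B A {h..p}" using principal J by auto
    \<comment> \<open>Independence of \<open>{h..p}\<close> gives one inequality. The other holds
      because \<open>B\<close> ends at \<open>A p\<close> and rises by at most one per step.\<close>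
    have tight: "B u + (p - u) = A p" if "h - 1 \<le> u" "u \<le> p" for u
    proof -
      have "{h..p} \<inter> {u<..p} = {u<..p}" using that by auto
      moreover have "card ({h..p} \<inter> {u<..p}) + B u \<le> A p"
        using \<open>fits p B A {h..p}\<close> that unfolding fits_def by blast
      ultimately have "p - u + B u \<le> A p" by simp
      then show ?thesis using unit_steps_mono[OF B that(2)] top by simp
    qed
    note tight' = tight[OF le_trans[OF diff_le_self]]
    have h: "A p = Suc p - h + B (h - 1)" using tight[of "h - 1"] principal(1,2) by linarith
    have A': "unit_steps (Suc p) A'"
      using A by (auto simp: unit_steps_def A'_def less_Suc_eq)
    have B': "unit_steps (Suc p) B'"
      unfolding unit_steps_def
    proof (intro conjI allI impI)
      show "B' 0 = 0" using principal B by (simp add: B'_def unit_steps_def)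
      fix j assume "j < Suc p"
      consider "Suc j < h" | "Suc j = h" | "h \<le> j" by linarith
      then show "B' (Suc j) = B' j \<or> B' (Suc j) = Suc (B' j)"
      proof cases
        case 1
        then show ?thesis using B principal by (simp add: B'_def unit_steps_def)
      next
        case 2
        then have "B' (Suc j) = A p + h - Suc p" "B' j = B (h - 1)" by (auto simp: B'_def)
        then show ?thesis using h principal by simp
      next
        case 3
        then show ?thesis by (auto simp: B'_def)
      qed
    qed
    have le': "B' j \<le> A' j" if "j \<le> Suc p" for j
    proof (cases "j = Suc p")
      case False
      then have "B' j \<le> B j" using that tight'[of j] by (auto simp: B'_def)
      then show ?thesis using le[of j] False that by (simp add: A'_def)
    qed (use principal(2) in \<open>simp add: A'_def B'_def\<close>)
    \<comment> \<open>By tightness, the inequalities with \<open>u \<ge> h\<close> already hold for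
      every \<open>Y\<close>, so lowering \<open>B\<close> there admits no new set.\<close>
    have same: "fits p B' A' Y \<longleftrightarrow> fits p B A Y" if "Y \<subseteq> {1..p}" for Y
    proof -
      have "card (Y \<inter> {u<..v}) + B' u \<le> A' v \<longleftrightarrow> card (Y \<inter> {u<..v}) + B u \<le> A v"
        if uv: "v \<le> p" "u \<le> v" for u v
      proof (cases "u < h")
        case False
        have "A p \<le> A v + (p - v)" using unit_steps_mono[OF A] uv by blast
        then have "card (Y \<inter> {u<..v}) + B u \<le> A v"
          using tight'[of u] False uv card_Int_Ioc_le[of Y u v] by simp
        moreover have "B' u \<le> B u" using tight'[of u] False uv by (simp add: B'_def)
        ultimately show ?thesis using uv by (simp add: A'_def)
      qed (use uv in \<open>simp add: A'_def B'_def\<close>)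
      then show ?thesis by (simp add: fits_def)
    qed
    \<comment> \<open>Keeps the subtraction in \<open>B'\<close> from truncating.\<close>
    have pos: "Suc p - u \<le> A p" if "h \<le> u" for u using h that principal by simp
    have slack: "p - u + B' u < A' p" if "h \<le> u" "u \<le> p" for u
      using that pos[of u] by (simp add: A'_def B'_def)
    have h': "A' p = Suc p - h + B' (h - 1)" using h principal by (simp add: A'_def B'_def)
    show ?thesis
    proof (rule extend[OF A' B' le' _ same])
      show "A' (Suc p) = B' (Suc p)" using principal by (simp add: A'_def B'_def)
      show "J (insert (Suc p) Y) \<longleftrightarrow> fits (Suc p) B' A' (insert (Suc p) Y)"
        if Y: "Y \<subseteq> {1..p}" "J Y" for Y
      proof -
        have "J (insert e Y) \<longleftrightarrow> fits p B' A' (insert e Y)" if "e \<in> {h..p} - Y" for e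
          using that Y principal J[of "insert e Y"] same[of "insert e Y"] by auto
        moreover have "fits p B' A' Y" using Y J same by blast
        ultimately show ?thesis
          using principal(4)[OF Y] fits_insert_Suc_iff_exchange[of p A' B' h Y]
            unit_steps_antimono[OF A'] unit_steps_antimono[OF B'] le'[of "Suc p"]
            principal(1,2) h' slack Y(1)
          by (auto simp: A'_def)
      qed
    qed
  qed
qed

section \<open>Lattice paths\<close>

definition norths :: "lattice_path \<Rightarrow> nat \<Rightarrow> nat" where
  "norths R j = count_list (take j R) North"

definition path_of :: "nat \<Rightarrow> (nat \<Rightarrow> nat) \<Rightarrow> lattice_path" where
  "path_of n C = map (\<lambda>j. if C (Suc j) = C j then East else North) [0..<n]"

section \<open>Points and heights of a path\<close>

lemma fold_move: "fold move R (a, b) = (a + count_list R East, b + count_list R North)"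
proof (induction R arbitrary: a b)
  case (Cons s R)
  then show ?case by (cases s) auto
qed simp

lemma count_East_North: "count_list R East + count_list R North = length R"
proof (induction R)
  case (Cons s R)
  then show ?case by (cases s) auto
qed simp

lemma endpoint_eq: "endpoint R = (length R - norths R (length R), norths R (length R))"
  using count_East_North[of R] by (simp add: endpoint_def fold_move norths_def)

lemma endpoint_take: "j \<le> length R \<Longrightarrow> endpoint (take j R) = (j - norths R j, norths R j)"
  using endpoint_eq[of "take j R"] by (simp add: norths_def)

lemma norths_le: "j \<le> length R \<Longrightarrow> norths R j \<le> j"
  using count_le_length[of "take j R" North] by (simp add: norths_def)

lemma endpoint_iff: "endpoint R = (m, r) \<longleftrightarrow> length R = m + r \<and> norths R (m + r) = r"
  using norths_le[of "length R" R] by (auto simp: endpoint_eq)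

lemma points_iff: "(a, b) \<in> points R \<longleftrightarrow> (\<exists>j \<le> length R. a = j - norths R j \<and> b = norths R j)"
proof -
  have "(a, b) \<in> points R \<longleftrightarrow> (\<exists>j \<le> length R. endpoint (take j R) = (a, b))"
    unfolding points_def mem_Collect_eq by metis
  also have "\<dots> \<longleftrightarrow> (\<exists>j \<le> length R. a = j - norths R j \<and> b = norths R j)"
    using endpoint_take by (intro ex_cong1) auto
  finally show ?thesis .
qed

lemma mem_points: "j \<le> length R \<Longrightarrow> (j - norths R j, norths R j) \<in> points R"
  using points_iff by blast

lemma norths_Suc: "j < length R \<Longrightarrow> norths R (Suc j) = norths R j + (if R ! j = North then 1 else 0)"
  by (simp add: norths_def take_Suc_conv_app_nth)

lemma unit_steps_norths: "unit_steps (length R) (norths R)"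
  by (auto simp: unit_steps_def norths_Suc) (simp add: norths_def)

lemma length_path_of [simp]: "length (path_of n C) = n"
  by (simp add: path_of_def)

lemma norths_path_of:
  assumes "unit_steps n C" "j \<le> n"
  shows "norths (path_of n C) j = C j"
  using assms(2)
proof (induction j)
  case 0
  then show ?case using assms(1) by (simp add: norths_def unit_steps_def)
next
  case (Suc j)
  then have "C (Suc j) = C j \<or> C (Suc j) = Suc (C j)" using assms(1) by (simp add: unit_steps_def)
  then show ?case using Suc norths_Suc[of j "path_of n C"] by (auto simp: path_of_def)
qed

text \<open>A discrete intermediate value property: the East coordinate \<open>k - C k\<close> grows
  by at most one per step. It yields a point of a path on a given vertical line.\<close>

lemma unit_steps_coordinate_attained:
  assumes "unit_steps n C" "i \<le> j" "j \<le> n" "i - C i \<le> a" "a \<le> j - C j"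
  shows "\<exists>k. i \<le> k \<and> k \<le> j \<and> k - C k = a"
  using assms(2-)
proof (induction j rule: dec_induct)
  case (step k)
  have "C (Suc k) = C k \<or> C (Suc k) = Suc (C k)"
    using assms(1) step.prems by (simp add: unit_steps_def)
  then have "Suc k - C (Suc k) \<le> Suc (k - C k)" by auto
  then consider "a \<le> k - C k" | "Suc k - C (Suc k) = a" using step.prems by linarith
  then show ?case
  proof cases
    case 1
    then show ?thesis using step by auto
  next
    case 2
    then show ?thesis using step.hyps by (intro exI[of _ "Suc k"]) simp
  qed
qed auto

context
  fixes R Q :: lattice_path and m r :: nat
  assumes R: "endpoint R = (m, r)" and Q: "endpoint Q = (m, r)"
begin

text \<open>Passes from vertical lines to comparison after equally many steps. If \<open>R\<close>
  is never higher in the latter sense, \<open>Q\<close> reaches the vertical line of a point of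
  \<open>R\<close> at the same step or later, hence at least as high. If \<open>R\<close> is higher
  after \<open>j\<close> steps, \<open>Q\<close> is then farther east, so it left that line earlier
  and lower.\<close>

lemma goes_above_iff: "goes_above R Q \<longleftrightarrow> (\<exists>j \<le> m + r. norths Q j < norths R j)"
proof
  have len: "length R = m + r" "length Q = m + r" and top: "norths Q (m + r) = r" "norths R (m + r) = r"
    using R Q by (auto simp: endpoint_iff)
  have QS: "unit_steps (m + r) (norths Q)" using unit_steps_norths[of Q] len by simp
  have RS: "unit_steps (m + r) (norths R)" using unit_steps_norths[of R] len by simp
  show "\<exists>j \<le> m + r. norths Q j < norths R j" if above: "goes_above R Q"
  proof (rule ccontr)
    assume no: "\<not> (\<exists>j \<le> m + r. norths Q j < norths R j)"
    obtain a b where ab: "(a, b) \<in> points R" "\<forall>b'. (a, b') \<in> points Q \<longrightarrow> b' < b"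
      using above unfolding goes_above_def by blast
    obtain j where j: "j \<le> m + r" "a = j - norths R j" "b = norths R j"
      using ab(1) len points_iff[of a b R] by auto
    \<comment> \<open>The common endpoint enters here: \<open>Q\<close> cannot stop before this
      vertical line.\<close>
    have "j - norths R j \<le> m"
      using unit_steps_mono[OF RS j(1) order_refl] top j(1) by linarith
    have "norths R j \<le> norths Q j" using no j(1) by (meson not_le)
    then have lower: "j - norths Q j \<le> a" unfolding j(2) by (rule diff_le_mono2)
    have upper: "a \<le> m + r - norths Q (m + r)"
      using \<open>j - norths R j \<le> m\<close> top(1) j(2) by simp
    obtain k where k: "j \<le> k" "k \<le> m + r" "k - norths Q k = a"
      using unit_steps_coordinate_attained[OF QS j(1) order_refl lower upper] by blast
    have "(a, norths Q k) \<in> points Q" using mem_points[of k Q] k(2,3) len(2) by simp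
    then have "norths Q k < norths R j" using ab(2) j(3) by blast
    moreover have "k = a + norths Q k" "j = a + norths R j"
      using norths_le[of j R] norths_le[of k Q] j(1,2) k(2,3) len by simp_all
    ultimately show False using k(1) by linarith
  qed
  show "goes_above R Q" if ex: "\<exists>j \<le> m + r. norths Q j < norths R j"
  proof -
    obtain j where j: "j \<le> m + r" "norths Q j < norths R j" using ex by blast
    define a where "a = j - norths R j"
    have ja: "j = a + norths R j" using norths_le[of j R] j(1) len(1) by (simp add: a_def)
    have "b' < norths R j" if b': "(a, b') \<in> points Q" for b'
    proof -
      obtain k where k: "k \<le> m + r" "a = k - norths Q k" "b' = norths Q k"
        using b' len points_iff[of a b' Q] by auto
      have ka: "k = a + norths Q k" using norths_le[of k Q] k(1,2) len(2) by simp
      have "k < j"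
      proof (rule ccontr)
        assume "\<not> k < j"
        then have "norths Q k \<le> norths Q j + (k - j)"
          using unit_steps_mono[OF QS, of j k] k(1) by simp
        then show False using \<open>\<not> k < j\<close> ka ja j(2) by linarith
      qed
      then show ?thesis using k(3) ka ja by linarith
    qed
    moreover have "(a, norths R j) \<in> points R" using mem_points[of j R] j(1) len(1) unfolding a_def by simp
    ultimately show ?thesis unfolding goes_above_def by blast
  qed
qed

text \<open>Mirror image of \<open>goes_above_iff\<close>: here \<open>Q\<close> meets the vertical
  line between the origin and step \<open>j\<close>.\<close>

lemma goes_below_iff: "goes_below R Q \<longleftrightarrow> (\<exists>j \<le> m + r. norths R j < norths Q j)"
proof
  have len: "length R = m + r" "length Q = m + r"
    using R Q by (auto simp: endpoint_iff)
  have QS: "unit_steps (m + r) (norths Q)" using unit_steps_norths[of Q] len by simp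
  show "\<exists>j \<le> m + r. norths R j < norths Q j" if below: "goes_below R Q"
  proof (rule ccontr)
    assume no: "\<not> (\<exists>j \<le> m + r. norths R j < norths Q j)"
    obtain a b where ab: "(a, b) \<in> points R" "\<forall>b'. (a, b') \<in> points Q \<longrightarrow> b < b'"
      using below unfolding goes_below_def by blast
    obtain j where j: "j \<le> m + r" "a = j - norths R j" "b = norths R j"
      using ab(1) len points_iff[of a b R] by auto
    have "norths Q j \<le> norths R j" using no j(1) by (meson not_le)
    then have upper: "a \<le> j - norths Q j" unfolding j(2) by (rule diff_le_mono2)
    have "0 - norths Q 0 \<le> a" by simp
    then obtain k where k: "k \<le> j" "k - norths Q k = a"
      using unit_steps_coordinate_attained[OF QS le0 j(1) _ upper] by blast
    have "(a, norths Q k) \<in> points Q" using mem_points[of k Q] k j(1) len(2) by simp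
    then have "norths R j < norths Q k" using ab(2) j(3) by blast
    moreover have "k = a + norths Q k" "j = a + norths R j"
      using norths_le[of j R] norths_le[of k Q] j(1,2) k len by simp_all
    ultimately show False using k(1) by linarith
  qed
  show "goes_below R Q" if ex: "\<exists>j \<le> m + r. norths R j < norths Q j"
  proof -
    obtain j where j: "j \<le> m + r" "norths R j < norths Q j" using ex by blast
    define a where "a = j - norths R j"
    have ja: "j = a + norths R j" using norths_le[of j R] j(1) len(1) by (simp add: a_def)
    have "norths R j < b'" if b': "(a, b') \<in> points Q" for b'
    proof -
      obtain k where k: "k \<le> m + r" "a = k - norths Q k" "b' = norths Q k"
        using b' len points_iff[of a b' Q] by auto
      have ka: "k = a + norths Q k" using norths_le[of k Q] k(1,2) len(2) by simp
      have "j < k"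
      proof (rule ccontr)
        assume "\<not> j < k"
        then have "norths Q j \<le> norths Q k + (j - k)"
          using unit_steps_mono[OF QS, of k j] j(1) by simp
        then show False using \<open>\<not> j < k\<close> ka ja j(2) by linarith
      qed
      then show ?thesis using k(3) ka ja by linarith
    qed
    moreover have "(a, norths R j) \<in> points R" using mem_points[of j R] j(1) len(1) unfolding a_def by simp
    ultimately show ?thesis unfolding goes_below_def by blast
  qed
qed

end

section \<open>The sets N_i and their partial transversals\<close>

lemma is_ith_north_step_iff:
  "is_ith_north_step R i j \<longleftrightarrow> 1 \<le> j \<and> j \<le> length R \<and> norths R (j - 1) < norths R j \<and> norths R j = i"
proof (cases "1 \<le> j \<and> j \<le> length R")
  case True
  then show ?thesis
    using norths_Suc[of "j - 1" R] by (auto simp: is_ith_north_step_def norths_def split: if_splits)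
qed (auto simp: is_ith_north_step_def)

text \<open>The inequalities say that \<open>j\<close> lies between the i-th North step of
  \<open>Q\<close> and that of \<open>P\<close>, so N_i is an interval. They are necessary because a
  path in the region has height \<open>i - 1\<close> before step \<open>j\<close> and
  \<open>i\<close> after it.\<close>

lemma mem_north_set_iff:
  assumes P: "endpoint P = (m, r)" and Q: "endpoint Q = (m, r)" and "\<not> goes_above P Q"
  shows "j \<in> north_set m r P Q i \<longleftrightarrow> 1 \<le> j \<and> j \<le> m + r \<and> norths P (j - 1) < i \<and> i \<le> norths Q j"
proof
  assume "j \<in> north_set m r P Q i"
  then obtain R where R: "endpoint R = (m, r)" "\<not> goes_above R Q" "\<not> goes_below R P"
    and north: "is_ith_north_step R i j"
    by (auto simp: north_set_def paths_between_def)
  have j: "1 \<le> j" "j \<le> m + r" "norths R (j - 1) < i" "norths R j = i"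
    using north R(1) by (auto simp: is_ith_north_step_iff endpoint_iff)
  have "norths R j \<le> norths Q j"
    using R(2) j(2) goes_above_iff[OF R(1) Q] by (meson not_le)
  moreover have "norths P (j - 1) \<le> norths R (j - 1)"
  proof -
    have "j - 1 \<le> m + r" using j(2) by simp
    then show ?thesis using R(3) goes_below_iff[OF R(1) P] by (meson not_le)
  qed
  ultimately show "1 \<le> j \<and> j \<le> m + r \<and> norths P (j - 1) < i \<and> i \<le> norths Q j" using j by auto
next
  assume j: "1 \<le> j \<and> j \<le> m + r \<and> norths P (j - 1) < i \<and> i \<le> norths Q j"
  define n where "n = m + r"
  have PS: "unit_steps n (norths P)" and QS: "unit_steps n (norths Q)"
    using unit_steps_norths[of P] unit_steps_norths[of Q] P Q by (simp_all add: endpoint_iff n_def)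
  have top: "norths P n = r" "norths Q n = r" using P Q by (simp_all add: endpoint_iff n_def)
  have PQ: "norths P k \<le> norths Q k" if "k \<le> n" for k
    using that assms(3) goes_above_iff[OF P Q] unfolding n_def by (meson not_le)
  \<comment> \<open>A jump from \<open>i - 1\<close> to \<open>i\<close> at step \<open>j\<close>,
    clamped between the heights of \<open>P\<close> and \<open>Q\<close>, is the height function of
    a path in the region. The inequalities ensure that clamping changes neither value next to the
    jump.\<close>
  define g where "g k = (if k < j then i - 1 else i)" for k
  define C where "C k = max (norths P k) (min (norths Q k) (g k))" for k
  have "C (Suc k) = C k \<or> C (Suc k) = Suc (C k)" if "k < n" for k
  proof -
    have "norths P (Suc k) = norths P k \<or> norths P (Suc k) = Suc (norths P k)"
      "norths Q (Suc k) = norths Q k \<or> norths Q (Suc k) = Suc (norths Q k)"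
      using that PS QS by (simp_all add: unit_steps_def)
    moreover have "g (Suc k) = g k \<or> g (Suc k) = Suc (g k)" using j by (auto simp: g_def)
    ultimately show ?thesis unfolding C_def by arith
  qed
  moreover have "C 0 = 0" using PS QS by (simp add: C_def unit_steps_def)
  ultimately have CS: "unit_steps n C" by (simp add: unit_steps_def)
  define R where "R = path_of n C"
  have RC: "norths R k = C k" if "k \<le> n" for k
    unfolding R_def by (rule norths_path_of[OF CS that])
  have "C n = r" by (simp add: C_def top)
  then have R: "endpoint R = (m, r)"
    using RC[of n] by (simp add: endpoint_iff n_def R_def)
  have "norths R k \<le> norths Q k" "norths P k \<le> norths R k" if "k \<le> m + r" for k
    using RC[of k] PQ[of k] that by (simp_all add: n_def C_def)
  then have "\<not> goes_above R Q" "\<not> goes_below R P"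
    unfolding goes_above_iff[OF R Q] goes_below_iff[OF R P] by (meson not_le)+
  moreover have "is_ith_north_step R i j"
  proof -
    have "norths P j \<le> Suc (norths P (j - 1))" "norths Q j \<le> Suc (norths Q (j - 1))"
      using unit_steps_mono[OF PS, of "j - 1" j] unit_steps_mono[OF QS, of "j - 1" j] j
      by (auto simp: n_def)
    then have "C j = i" "C (j - 1) = i - 1"
      using j by (auto simp: C_def g_def)
    then show ?thesis
      using RC[of j] RC[of "j - 1"] j by (auto simp: is_ith_north_step_iff R_def n_def)
  qed
  ultimately show "j \<in> north_set m r P Q i"
    using R by (auto simp: north_set_def paths_between_def)
qed

text \<open>The easy half of Hall's theorem: the elements in \<open>{u<..v}\<close> receive distinct
  labels in \<open>{B u<..A v}\<close>.\<close>

lemma fits_of_transversal: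
  assumes A: "unit_steps n A" and B: "unit_steps n B" and BA: "\<And>j. j \<le> n \<Longrightarrow> B j \<le> A j"
    and I: "I \<subseteq> {1..n}" and \<phi>: "inj_on \<phi> I" "\<And>e. e \<in> I \<Longrightarrow> B (e - 1) < \<phi> e \<and> \<phi> e \<le> A e"
  shows "fits n B A I"
  unfolding fits_def
proof (intro allI impI)
  fix u v assume uv: "v \<le> n" "u \<le> v"
  have "\<phi> ` (I \<inter> {u<..v}) \<subseteq> {B u<..A v}"
  proof clarify
    fix e assume e: "e \<in> I" "e \<in> {u<..v}"
    have "B u \<le> B (e - 1)" using unit_steps_mono[OF B, of u "e - 1"] e(2) uv by auto
    moreover have "A e \<le> A v" using unit_steps_mono[OF A, of e v] e(2) uv by auto
    ultimately show "\<phi> e \<in> {B u<..A v}" using \<phi>(2)[OF e(1)] by auto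
  qed
  then have "card (\<phi> ` (I \<inter> {u<..v})) \<le> A v - B u"
    using card_mono[of "{B u<..A v}"] by simp
  moreover have "card (\<phi> ` (I \<inter> {u<..v})) = card (I \<inter> {u<..v})"
    by (rule card_image) (use \<phi>(1) inj_on_subset in blast)
  moreover have "B u \<le> A v" using BA[of u] unit_steps_mono[OF A, of u v] uv by simp
  ultimately show "card (I \<inter> {u<..v}) + B u \<le> A v" by simp
qed

fun greedy :: "(nat \<Rightarrow> nat) \<Rightarrow> nat set \<Rightarrow> nat \<Rightarrow> nat" where
  "greedy B I 0 = 0"
| "greedy B I (Suc v) = max (B (Suc v)) (greedy B I v + (if Suc v \<in> I then 1 else 0))"

text \<open>The north steps of the lowest path above \<open>B\<close> that goes north at each element of \<open>I\<close>
  number the transversal; the path stays below \<open>A\<close> by the counting inequalities.\<close>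

lemma transversal_of_fits:
  assumes A: "unit_steps n A" and B: "unit_steps n B" and I: "I \<subseteq> {1..n}" and fits: "fits n B A I"
  shows "\<exists>\<phi>. inj_on \<phi> I \<and> (\<forall>e \<in> I. B (e - 1) < \<phi> e \<and> \<phi> e \<le> A e)"
proof -
  let ?g = "greedy B I"
  have ge: "B v \<le> ?g v" if "v \<le> n" for v
    using that B by (cases v) (auto simp: unit_steps_def)
  \<comment> \<open>Take for \<open>u\<close> the last position at which \<open>B\<close> forced the
    path up, or 0. Since then the path rose only at elements of \<open>I\<close>, so a single
    counting inequality bounds its height.\<close>
  have attained: "\<exists>u \<le> v. ?g v = card (I \<inter> {u<..v}) + B u" if "v \<le> n" for v
    using that
  proof (induction v)
    case 0
    then show ?case using B by (simp add: unit_steps_def)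
  next
    case (Suc v)
    then obtain u where u: "u \<le> v" "?g v = card (I \<inter> {u<..v}) + B u" by auto
    have "card (I \<inter> {u<..Suc v}) = card (I \<inter> {u<..v}) + (if Suc v \<in> I then 1 else 0)"
    proof -
      have "{u<..Suc v} = insert (Suc v) {u<..v}" using u(1) by auto
      then show ?thesis by simp
    qed
    then consider "?g (Suc v) = B (Suc v)" | "?g (Suc v) = card (I \<inter> {u<..Suc v}) + B u"
      using u(2) by (cases "B (Suc v) \<le> ?g v + (if Suc v \<in> I then 1 else 0)") auto
    then show ?case
    proof cases
      case 1
      then show ?thesis by (intro exI[of _ "Suc v"]) simp
    next
      case 2
      then show ?thesis using u(1) by (intro exI[of _ u]) simp
    qed
  qed
  have le: "?g v \<le> A v" if "v \<le> n" for v
    using attained[OF that] fitsD[OF fits that] by auto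
  \<comment> \<open>\<open>B\<close> rises by at most one and is below the path before
    \<open>e\<close>, so it never forces a larger jump.\<close>
  have step: "?g e = Suc (?g (e - 1))" if "e \<in> I" for e
  proof -
    have "1 \<le> e" "e \<le> n" using that I by auto
    then obtain d where d: "e = Suc d" "d < n" by (cases e) auto
    have "B (Suc d) \<le> Suc (B d)" using B d(2) by (auto simp: unit_steps_def)
    then show ?thesis using ge[of d] d that by simp
  qed
  have mono: "?g d \<le> ?g e" if "d \<le> e" for d e
    using that by (induction e rule: dec_induct) auto
  have "?g d < ?g e" if "d \<in> I" "e \<in> I" "d < e" for d e
  proof -
    have "d \<le> e - 1" using that(3) by simp
    then show ?thesis using mono[of d "e - 1"] step[OF that(2)] by simp
  qed
  then have "inj_on ?g I" by (intro inj_onI) (metis less_irrefl linorder_neqE_nat)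
  moreover have "B (e - 1) < ?g e \<and> ?g e \<le> A e" if "e \<in> I" for e
  proof -
    have "e \<le> n" using that I by auto
    then have "e - 1 \<le> n" by simp
    then show ?thesis using step[OF that] ge[of "e - 1"] le[of e] \<open>e \<le> n\<close> by simp
  qed
  ultimately show ?thesis by blast
qed

lemma indep_path_matroid_iff:
  assumes P: "endpoint P = (m, r)" and Q: "endpoint Q = (m, r)" and PQ: "\<not> goes_above P Q"
    and I: "I \<subseteq> {1..m + r}"
  shows "I \<in> indep (path_matroid m r P Q) \<longleftrightarrow> fits (m + r) (norths P) (norths Q) I"
proof -
  have PS: "unit_steps (m + r) (norths P)" and QS: "unit_steps (m + r) (norths Q)"
    and top: "norths Q (m + r) = r"
    using unit_steps_norths[of P] unit_steps_norths[of Q] P Q by (simp_all add: endpoint_iff)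
  have le: "norths P k \<le> norths Q k" if "k \<le> m + r" for k
    using that PQ goes_above_iff[OF P Q] by (meson not_le)
  have mem: "e \<in> north_set m r P Q i \<longleftrightarrow> norths P (e - 1) < i \<and> i \<le> norths Q e" if "e \<in> I" for e i
    using mem_north_set_iff[OF P Q PQ] that I by auto
  have bound: "norths Q e \<le> r" if "e \<in> I" for e
    using unit_steps_mono[OF QS, of e "m + r"] top that I by auto
  have "I \<in> indep (path_matroid m r P Q) \<longleftrightarrow>
    (\<exists>\<phi>. inj_on \<phi> I \<and> \<phi> ` I \<subseteq> {1..r} \<and> (\<forall>e \<in> I. norths P (e - 1) < \<phi> e \<and> \<phi> e \<le> norths Q e))"
    using I mem by (simp add: path_matroid_def transversal_matroid_def)
  \<comment> \<open>The labels lie in \<open>{1..r}\<close> automatically, since \<open>Q\<close>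
    ends at height \<open>r\<close>.\<close>
  also have "\<dots> \<longleftrightarrow> (\<exists>\<phi>. inj_on \<phi> I \<and> (\<forall>e \<in> I. norths P (e - 1) < \<phi> e \<and> \<phi> e \<le> norths Q e))"
  proof (intro ex_cong1 conj_cong refl)
    fix \<phi>
    show "(\<phi> ` I \<subseteq> {1..r} \<and> (\<forall>e \<in> I. norths P (e - 1) < \<phi> e \<and> \<phi> e \<le> norths Q e)) \<longleftrightarrow>
      (\<forall>e \<in> I. norths P (e - 1) < \<phi> e \<and> \<phi> e \<le> norths Q e)"
    proof -
      have "\<phi> e \<in> {1..r}" if "e \<in> I" "norths P (e - 1) < \<phi> e \<and> \<phi> e \<le> norths Q e" for e
        using bound[OF that(1)] that(2) by auto
      then show ?thesis by blast
    qed
  qed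
  also have "\<dots> \<longleftrightarrow> fits (m + r) (norths P) (norths Q) I"
  proof
    assume "\<exists>\<phi>. inj_on \<phi> I \<and> (\<forall>e \<in> I. norths P (e - 1) < \<phi> e \<and> \<phi> e \<le> norths Q e)"
    then obtain \<phi> where "inj_on \<phi> I" "\<forall>e \<in> I. norths P (e - 1) < \<phi> e \<and> \<phi> e \<le> norths Q e"
      by blast
    then show "fits (m + r) (norths P) (norths Q) I"
      using fits_of_transversal[OF QS PS le I] by simp
  qed (rule transversal_of_fits[OF QS PS I])
  finally show ?thesis .
qed

section \<open>Orderings of the ground set\<close>

lemma extension_by_restrict_to:
  assumes "matroid M" "insert y X \<subseteq> ground M" "y \<notin> X"
  shows "extension_by (restrict_to M X) y (restrict_to M (insert y X))"
  unfolding extension_by_def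
proof (intro conjI)
  show "matroid (restrict_to M (insert y X))" using matroid.matroid_restrict_to assms(1) .
  show "restrict_to (restrict_to M (insert y X)) (ground (restrict_to M X)) = restrict_to M X"
  proof -
    have X: "X \<subseteq> ground M" "X \<subseteq> insert y X" using assms(2) by blast+
    have "ground M \<inter> insert y X \<inter> (ground M \<inter> X) = ground M \<inter> X" by blast
    moreover have "ground M \<inter> X = X" using X(1) by (rule Int_absorb1)
    moreover have "{I \<in> {I \<in> indep M. I \<subseteq> insert y X}. I \<subseteq> X} = {I \<in> indep M. I \<subseteq> X}"
      using X(2) by (simp add: conj_commute conj_left_commute) (metis subset_trans)
    ultimately show ?thesis by (simp only: restrict_to_def set_system.simps)
  qed
  show "y \<notin> ground (restrict_to M X)" using assms(3) by (simp add: ground_restrict_to)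
  show "ground (restrict_to M (insert y X)) = insert y (ground (restrict_to M X))"
    using assms(2) unfolding ground_restrict_to by blast
qed

lemma elementary_step_iff:
  assumes M: "matroid M" and inj: "inj_on x {1..Suc p}" and x: "x ` {1..Suc p} \<subseteq> ground M"
  defines "M_prev \<equiv> restrict_to M (x ` {1..p})" and "M_cur \<equiv> restrict_to M (x ` {1..Suc p})"
  shows "adds_isthmus M_prev (x (Suc p)) M_cur \<or> adds_loop M_prev (x (Suc p)) M_cur \<or>
      (\<exists>h. 1 \<le> h \<and> h < Suc p \<and> x ` {h..p} \<in> indep M_prev \<and>
        principal_extension M_prev (closure M_prev (x ` {h..p})) (x (Suc p)) M_cur)
    \<longleftrightarrow> elementary_step (\<lambda>Y. x ` Y \<in> indep M) p"
proof -
  interpret matroid M by fact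
  have image_Suc: "x ` {1..Suc p} = insert (x (Suc p)) (x ` {1..p})"
    by (auto simp: atLeastAtMostSuc_conv)
  have new: "x (Suc p) \<notin> x ` {1..p}"
  proof
    assume "x (Suc p) \<in> x ` {1..p}"
    then obtain d where "d \<in> {1..p}" "x (Suc p) = x d" by blast
    then show False using inj_onD[OF inj, of "Suc p" d] by auto
  qed
  have ext: "extension_by M_prev (x (Suc p)) M_cur"
    unfolding M_prev_def M_cur_def image_Suc
    by (rule extension_by_restrict_to[OF M _ new]) (use x image_Suc in simp)
  have prev: "matroid M_prev" unfolding M_prev_def by (rule matroid_restrict_to)
  \<comment> \<open>Transports quantification over independent sets of the restriction to sets of
    positions.\<close>
  have ball: "(\<forall>I \<in> indep M_prev. \<psi> I) \<longleftrightarrow> (\<forall>Y \<subseteq> {1..p}. x ` Y \<in> indep M \<longrightarrow> \<psi> (x ` Y))" for \<psi>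
  proof
    assume all: "\<forall>I \<in> indep M_prev. \<psi> I"
    show "\<forall>Y \<subseteq> {1..p}. x ` Y \<in> indep M \<longrightarrow> \<psi> (x ` Y)"
    proof (intro allI impI)
      fix Y assume "Y \<subseteq> {1..p}" "x ` Y \<in> indep M"
      then have "x ` Y \<in> indep M_prev"
        unfolding M_prev_def indep_restrict_to_iff using image_mono by blast
      then show "\<psi> (x ` Y)" using all by blast
    qed
  next
    assume all: "\<forall>Y \<subseteq> {1..p}. x ` Y \<in> indep M \<longrightarrow> \<psi> (x ` Y)"
    show "\<forall>I \<in> indep M_prev. \<psi> I"
    proof
      fix I assume "I \<in> indep M_prev"
      then have I: "I \<in> indep M" "I \<subseteq> x ` {1..p}"
        unfolding M_prev_def indep_restrict_to_iff by blast+
      then obtain Y where "Y \<subseteq> {1..p}" "I = x ` Y" by (auto simp only: subset_image_iff)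
      then show "\<psi> I" using all I(1) by blast
    qed
  qed
  have cur: "insert (x (Suc p)) (x ` Y) \<in> indep M_cur \<longleftrightarrow> x ` insert (Suc p) Y \<in> indep M"
    if "Y \<subseteq> {1..p}" for Y
  proof -
    have "x ` Y \<subseteq> x ` {1..p}" using that by (rule image_mono)
    then have "insert (x (Suc p)) (x ` Y) \<subseteq> insert (x (Suc p)) (x ` {1..p})" by blast
    then show ?thesis unfolding M_cur_def indep_restrict_to_iff image_Suc by simp
  qed
  have isthmus: "adds_isthmus M_prev (x (Suc p)) M_cur \<longleftrightarrow>
      (\<forall>Y \<subseteq> {1..p}. x ` Y \<in> indep M \<longrightarrow> x ` insert (Suc p) Y \<in> indep M)"
    unfolding adds_isthmus_iff[OF ext] ball by (intro all_cong imp_cong refl cur)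
  have loop: "adds_loop M_prev (x (Suc p)) M_cur \<longleftrightarrow> x ` {Suc p} \<notin> indep M"
  proof -
    have "x (Suc p) \<in> ground M_cur" using extension_byD(3)[OF ext] by simp
    then show ?thesis using ext cur[of "{}"] by (simp add: adds_loop_def loop_def)
  qed
  have principal: "x ` {h..p} \<in> indep M_prev \<and>
        principal_extension M_prev (closure M_prev (x ` {h..p})) (x (Suc p)) M_cur \<longleftrightarrow>
      x ` {h..p} \<in> indep M \<and> (\<forall>Y \<subseteq> {1..p}. x ` Y \<in> indep M \<longrightarrow>
        (x ` insert (Suc p) Y \<in> indep M \<longleftrightarrow> (\<exists>e \<in> {h..p} - Y. x ` insert e Y \<in> indep M)))"
    if h: "1 \<le> h" for h
  proof -
    have sub: "{h..p} \<subseteq> {1..p}" using h by auto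
    have "x ` {h..p} \<subseteq> x ` {1..p}" using sub by (rule image_mono)
    moreover have "x ` {1..p} \<subseteq> ground M" using x image_Suc by blast
    ultimately have S: "x ` {h..p} \<subseteq> ground M_prev" unfolding M_prev_def ground_restrict_to by blast
    have exchange: "(\<exists>e \<in> x ` {h..p} - x ` Y. insert e (x ` Y) \<in> indep M_prev) \<longleftrightarrow>
      (\<exists>e \<in> {h..p} - Y. x ` insert e Y \<in> indep M)" if Y: "Y \<subseteq> {1..p}" for Y
    proof -
      have "inj_on x {1..p}" using inj by (rule inj_on_subset) auto
      then have "x ` {h..p} - x ` Y = x ` ({h..p} - Y)"
        using inj_on_image_set_diff[of x "{1..p}" "{h..p}" Y] sub Y by blast
      moreover have "insert (x e) (x ` Y) \<in> indep M_prev \<longleftrightarrow> x ` insert e Y \<in> indep M"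
        if "e \<in> {h..p} - Y" for e
      proof -
        have "x ` insert e Y \<subseteq> x ` {1..p}" using that sub Y by (intro image_mono) blast
        then show ?thesis unfolding M_prev_def indep_restrict_to_iff by simp
      qed
      ultimately show ?thesis by simp
    qed
    have "principal_extension M_prev (closure M_prev (x ` {h..p})) (x (Suc p)) M_cur \<longleftrightarrow>
      (\<forall>Y \<subseteq> {1..p}. x ` Y \<in> indep M \<longrightarrow> (x ` insert (Suc p) Y \<in> indep M \<longleftrightarrow>
        (\<exists>e \<in> {h..p} - Y. x ` insert e Y \<in> indep M)))"
      unfolding principal_extension_closure_iff[OF prev ext S] ball
      by (intro all_cong imp_cong refl arg_cong2[where f = "(=)"] cur exchange)
    moreover have "x ` {h..p} \<in> indep M_prev \<longleftrightarrow> x ` {h..p} \<in> indep M"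
      using \<open>x ` {h..p} \<subseteq> x ` {1..p}\<close> by (simp add: M_prev_def indep_restrict_to_iff)
    ultimately show ?thesis by simp
  qed
  have "(\<exists>h. 1 \<le> h \<and> h < Suc p \<and> x ` {h..p} \<in> indep M_prev \<and>
        principal_extension M_prev (closure M_prev (x ` {h..p})) (x (Suc p)) M_cur) \<longleftrightarrow>
      (\<exists>h. 1 \<le> h \<and> h \<le> p \<and> x ` {h..p} \<in> indep M \<and> (\<forall>Y \<subseteq> {1..p}. x ` Y \<in> indep M \<longrightarrow>
        (x ` insert (Suc p) Y \<in> indep M \<longleftrightarrow> (\<exists>e \<in> {h..p} - Y. x ` insert e Y \<in> indep M))))"
    unfolding less_Suc_eq_le
    by (rule ex_cong1, rule conj_cong[OF refl], rule conj_cong[OF refl], rule principal)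
  then show ?thesis unfolding isthmus loop elementary_step_def by argo
qed

text \<open>Turns the isomorphism around, so that it enumerates the ground set of \<open>M\<close>
  by the positions of steps.\<close>

lemma isomorphic_iff_inverse:
  "isomorphic M N \<longleftrightarrow> (\<exists>x. bij_betw x (ground N) (ground M) \<and>
    (\<forall>Y \<subseteq> ground N. x ` Y \<in> indep M \<longleftrightarrow> Y \<in> indep N))"
proof
  assume "isomorphic M N"
  then obtain f where f: "bij_betw f (ground M) (ground N)"
    "\<And>X. X \<subseteq> ground M \<Longrightarrow> X \<in> indep M \<longleftrightarrow> f ` X \<in> indep N"
    unfolding isomorphic_def by blast
  define x where "x = the_inv_into (ground M) f"
  have x: "bij_betw x (ground N) (ground M)" unfolding x_def by (rule bij_betw_the_inv_into[OF f(1)])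
  have "x ` Y \<in> indep M \<longleftrightarrow> Y \<in> indep N" if "Y \<subseteq> ground N" for Y
  proof -
    have "x ` Y \<subseteq> ground M" using x that by (auto simp: bij_betw_def)
    moreover have "f ` x ` Y = Y"
    proof -
      have "f (x y) = y" if "y \<in> Y" for y
        unfolding x_def by (rule f_the_inv_into_f_bij_betw[OF f(1)]) (use \<open>Y \<subseteq> ground N\<close> that in blast)
      then show ?thesis by (simp add: image_image)
    qed
    ultimately show ?thesis using f(2)[of "x ` Y"] by simp
  qed
  then show "\<exists>x. bij_betw x (ground N) (ground M) \<and>
    (\<forall>Y \<subseteq> ground N. x ` Y \<in> indep M \<longleftrightarrow> Y \<in> indep N)" using x by blast
next
  assume "\<exists>x. bij_betw x (ground N) (ground M) \<and> (\<forall>Y \<subseteq> ground N. x ` Y \<in> indep M \<longleftrightarrow> Y \<in> indep N)"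
  then obtain x where x: "bij_betw x (ground N) (ground M)"
    "\<And>Y. Y \<subseteq> ground N \<Longrightarrow> x ` Y \<in> indep M \<longleftrightarrow> Y \<in> indep N" by blast
  define f where "f = the_inv_into (ground N) x"
  have f: "bij_betw f (ground M) (ground N)" unfolding f_def by (rule bij_betw_the_inv_into[OF x(1)])
  have "X \<in> indep M \<longleftrightarrow> f ` X \<in> indep N" if "X \<subseteq> ground M" for X
  proof -
    have "f ` X \<subseteq> ground N" using f that by (auto simp: bij_betw_def)
    moreover have "x ` f ` X = X"
    proof -
      have "x (f y) = y" if "y \<in> X" for y
        unfolding f_def by (rule f_the_inv_into_f_bij_betw[OF x(1)]) (use \<open>X \<subseteq> ground M\<close> that in blast)
      then show ?thesis by (simp add: image_image)
    qed
    ultimately show ?thesis using x(2)[of "f ` X"] by simp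
  qed
  then show "isomorphic M N" unfolding isomorphic_def using f by blast
qed

lemma ground_path_matroid: "ground (path_matroid m r P Q) = {1..m + r}"
  by (simp add: path_matroid_def transversal_matroid_def)

lemma lattice_path_matroid_iff_elementary_steps:
  assumes "matroid M"
  shows "lattice_path_matroid M \<longleftrightarrow> (\<exists>n x. bij_betw x {1..n} (ground M) \<and>
    (\<forall>p < n. elementary_step (\<lambda>Y. x ` Y \<in> indep M) p))"
proof
  interpret matroid M by fact
  assume "lattice_path_matroid M"
  then obtain m r P Q where P: "endpoint P = (m, r)" and Q: "endpoint Q = (m, r)"
    and PQ: "\<not> goes_above P Q" and "isomorphic M (path_matroid m r P Q)"
    unfolding lattice_path_matroid_def by blast
  then obtain x where x: "bij_betw x {1..m + r} (ground M)"
    and indep: "\<And>Y. Y \<subseteq> {1..m + r} \<Longrightarrow> x ` Y \<in> indep M \<longleftrightarrow> Y \<in> indep (path_matroid m r P Q)"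
    unfolding isomorphic_iff_inverse ground_path_matroid by blast
  have PS: "unit_steps (m + r) (norths P)" and QS: "unit_steps (m + r) (norths Q)"
    using unit_steps_norths[of P] unit_steps_norths[of Q] P Q by (simp_all add: endpoint_iff)
  have le: "norths P j \<le> norths Q j" if "j \<le> m + r" for j
    using that PQ goes_above_iff[OF P Q] by (meson not_le)
  have J: "x ` Y \<in> indep M \<longleftrightarrow> fits (m + r) (norths P) (norths Q) Y" if "Y \<subseteq> {1..m + r}" for Y
    using indep[OF that] indep_path_matroid_iff[OF P Q PQ that] by simp
  have "elementary_step (\<lambda>Y. x ` Y \<in> indep M) p" if "p < m + r" for p
    by (rule elementary_step_fits[OF QS PS le J that])
  then show "\<exists>n x. bij_betw x {1..n} (ground M) \<and>
    (\<forall>p < n. elementary_step (\<lambda>Y. x ` Y \<in> indep M) p)" using x by blast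
next
  interpret matroid M by fact
  assume "\<exists>n x. bij_betw x {1..n} (ground M) \<and>
    (\<forall>p < n. elementary_step (\<lambda>Y. x ` Y \<in> indep M) p)"
  then obtain n x where x: "bij_betw x {1..n} (ground M)"
    and step: "\<And>p. p < n \<Longrightarrow> elementary_step (\<lambda>Y. x ` Y \<in> indep M) p" by blast
  have "\<exists>A B. unit_steps n A \<and> unit_steps n B \<and> (\<forall>j \<le> n. B j \<le> A j) \<and> A n = B n \<and>
    (\<forall>Y \<subseteq> {1..n}. x ` Y \<in> indep M \<longleftrightarrow> fits n B A Y)"
  proof (rule fits_of_elementary_steps[OF _ _ step])
    show "x ` Z \<in> indep M" if "x ` Y \<in> indep M" "Z \<subseteq> Y" for Y Z
      using that(1) by (rule indep_subset) (rule image_mono[OF that(2)])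
  qed (use empty_indep in simp_all)
  then obtain A B where A: "unit_steps n A" and B: "unit_steps n B"
    and le: "\<And>j. j \<le> n \<Longrightarrow> B j \<le> A j" and top: "A n = B n"
    and J: "\<And>Y. Y \<subseteq> {1..n} \<Longrightarrow> x ` Y \<in> indep M \<longleftrightarrow> fits n B A Y" by blast
  \<comment> \<open>\<open>A\<close> and \<open>B\<close> end at this common height, so both paths
    end at \<open>(m, r)\<close>.\<close>
  define r where "r = A n"
  define m where "m = n - r"
  have n: "m + r = n" using unit_steps_le[OF A order_refl] by (simp add: m_def r_def)
  define P where "P = path_of n B"
  define Q where "Q = path_of n A"
  have norths: "norths P j = B j" "norths Q j = A j" if "j \<le> n" for j
    unfolding P_def Q_def using that norths_path_of A B by blast+
  have P: "endpoint P = (m, r)" and Q: "endpoint Q = (m, r)"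
  proof -
    have "length P = m + r" "length Q = m + r" by (simp_all add: P_def Q_def n)
    moreover have "norths P (m + r) = r" "norths Q (m + r) = r"
      unfolding n using norths[of n] top by (simp_all add: r_def)
    ultimately show "endpoint P = (m, r)" "endpoint Q = (m, r)" by (simp_all add: endpoint_iff)
  qed
  have PQ: "\<not> goes_above P Q"
    using goes_above_iff[OF P Q] norths le n by (metis not_le)
  have "x ` Y \<in> indep M \<longleftrightarrow> Y \<in> indep (path_matroid m r P Q)" if "Y \<subseteq> {1..m + r}" for Y
  proof -
    have "fits n B A Y \<longleftrightarrow> fits n (norths P) (norths Q) Y" by (simp add: fits_def norths)
    then show ?thesis using J[of Y] indep_path_matroid_iff[OF P Q PQ that] that n by simp
  qed
  then have "isomorphic M (path_matroid m r P Q)"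
    unfolding isomorphic_iff_inverse ground_path_matroid using x n by blast
  then show "lattice_path_matroid M"
    unfolding lattice_path_matroid_def using assms P Q PQ by blast
qed

theorem theorem6p7:
  fixes M :: "'a set_system"
  assumes "matroid M"
  shows "lattice_path_matroid M \<longleftrightarrow>
    (\<exists>(k::nat) (x :: nat \<Rightarrow> 'a). bij_betw x {1..k} (ground M) \<and>
       (\<forall>i \<in> {1..k}.
          let M_prev = restrict_to M (x ` {1..i - 1});
              M_cur = restrict_to M (x ` {1..i})
          in adds_isthmus M_prev (x i) M_cur
           \<or> adds_loop M_prev (x i) M_cur
           \<or> (\<exists>h. 1 \<le> h \<and> h < i \<and> x ` {h..i - 1} \<in> indep M_prev \<and>
                principal_extension M_prev (closure M_prev (x ` {h..i - 1})) (x i) M_cur)))"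
proof -
  \<comment> \<open>The shift \<open>i = Suc p\<close> turns \<open>i - 1\<close> into
    \<open>p\<close>, matching \<open>elementary_step\<close>.\<close>
  have range: "(\<forall>i \<in> {1..k}. \<psi> i) \<longleftrightarrow> (\<forall>p < k. \<psi> (Suc p))" for k :: nat and \<psi>
  proof
    assume all: "\<forall>p < k. \<psi> (Suc p)"
    show "\<forall>i \<in> {1..k}. \<psi> i"
    proof
      fix i assume i: "i \<in> {1..k}"
      then have "i - 1 < k" "Suc (i - 1) = i" by auto
      then show "\<psi> i" using all by metis
    qed
  qed simp
  have step: "(let M_prev = restrict_to M (x ` {1..Suc p - 1});
              M_cur = restrict_to M (x ` {1..Suc p})
          in adds_isthmus M_prev (x (Suc p)) M_cur
           \<or> adds_loop M_prev (x (Suc p)) M_cur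
           \<or> (\<exists>h. 1 \<le> h \<and> h < Suc p \<and> x ` {h..Suc p - 1} \<in> indep M_prev \<and>
                principal_extension M_prev (closure M_prev (x ` {h..Suc p - 1})) (x (Suc p)) M_cur))
      \<longleftrightarrow> elementary_step (\<lambda>Y. x ` Y \<in> indep M) p"
    if "bij_betw x {1..k} (ground M)" "p < k" for x k p
  proof -
    have sub: "{1..Suc p} \<subseteq> {1..k}" using that(2) by auto
    have inj: "inj_on x {1..k}" and img: "x ` {1..k} = ground M"
      using that(1) by (simp_all add: bij_betw_def)
    have "inj_on x {1..Suc p}" using inj sub by (rule inj_on_subset)
    moreover have "x ` {1..Suc p} \<subseteq> ground M" using image_mono[OF sub, of x] img by simp
    ultimately show ?thesis using elementary_step_iff[OF assms, of x p] by (simp only: Let_def diff_Suc_1)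
  qed
  show ?thesis
    unfolding lattice_path_matroid_iff_elementary_steps[OF assms] range
    by (intro ex_cong1 conj_cong refl all_cong step[symmetric])
qed

end
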